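(* For every $d\ge1$, $$N^{\mathrm{Wend}}_{n,d}=N^{\mathrm{Wend}}_{n-1,d}+N^{\mathrm{Wend}}_{n-1,d-1},\qquad n\ge d+1,$$ $$N^{\mathrm{walk}}_{n,d}=(2n-1)N^{\mathrm{walk}}_{n-1,d}+N^{\mathrm{walk}}_{n-1,d-1},\qquad n\ge d+1,$$ $$N^{\mathrm{br}}_{n,d}=(n-1)N^{\mathrm{br}}_{n-1,d}+N^{\mathrm{br}}_{n-1,d-1},\qquad n\ge d+2,$$ where for $n\ge1$ one uses the boundary conditions $N^{\mathrm{Wend}}_{n,0}=2^n$, $N^{\mathrm{Wend}}_{n,n}=0$, $N^{\mathrm{walk}}_{n,0}=2^nn!$, $N^{\mathrm{walk}}_{n,n}=0$, and for $n\ge2$ one sets $N^{\mathrm{br}}_{n,0}=n!$, $N^{\mathrm{br}}_{n,n-1}=0$.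
   Context: For a matrix $X=(x_1|\dots|x_n)$ with columns in $\mathbb{R}^d$ write $s_k(X)=x_1+\dots+x_k$. In each model below, the number $N_{n,d}$ is the same for every regular configuration $X$, so it depends on $n$ and $d$ only; polytopes are counted with multiplicity, i.e. one counts group elements. Wendel model ($d\ge1$, $n\ge d+1$): $X\in\mathbb{R}^{d\times n}$ is regular if any $d$ of its columns are linearly independent. $N^{\mathrm{Wend}}_{n,d}$ is the number of $\varepsilon\in\{\pm1\}^n$ with $0\in\operatorname{Conv}(\varepsilon_1x_1,\dots,\varepsilon_nx_n)$. Walk model ($d\ge1$, $n\ge d+1$): $\mathfrak B_n$ is the group of signed permutations $g=(\sigma,\varepsilon)$, $\sigma$ a permutation of $\{1,\dots,n\}$, $\varepsilon\in\{\pm1\}^n$, acting by $gX=(\varepsilon_1x_{\sigma(1)}|\dots|\varepsilon_nx_{\sigma(n)})$. $X\in\mathbb{R}^{d\times n}$ is regular if for every $g\in\mathfrak B_n$ any $d$ of the vectors $s_1(gX),\dots,s_n(gX)$ are linearly independent. $N^{\mathrm{walk}}_{n,d}$ is the number of $g\in\mathfrak B_n$ with $0\in\operatorname{Conv}(s_1(gX),\dots,s_n(gX))$. Bridge model ($d\ge1$, $n\ge d+2$): configurations are $X=(x_1|\dots|x_n)\in\mathbb{R}^{d\times n}$ with $x_1+\dots+x_n=0$, and the symmetric group $\mathfrak S_n$ acts by $\sigma X=(x_{\sigma(1)}|\dots|x_{\sigma(n)})$. $X$ is regular if for every $\sigma\in\mathfrak S_n$ any $d$ of the vectors $s_1(\sigma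 X),\dots,s_{n-1}(\sigma X)$ are linearly independent. $N^{\mathrm{br}}_{n,d}$ is the number of $\sigma\in\mathfrak S_n$ with $0\in\operatorname{Conv}(s_1(\sigma X),\dots,s_{n-1}(\sigma X))$. *)

theory Defs
  imports
    "HOL-Analysis.Analysis"
    "HOL-Analysis.Finite_Function_Topology"
    "HOL-Combinatorics.Permutations"
begin

text \<open>
  Since the dimension \<open>d\<close> varies inside the statement, \<open>\<real>\<^sup>d\<close> is realised as the subspace of
  vectors supported on the coordinates \<open>1, \<dots>, d\<close> of the real vector space of finitely supported
  real sequences. A configuration, i.e. a \<open>d \<times> n\<close> matrix, is given by its columns
  \<open>x 1, \<dots>, x n\<close>; the values of \<open>x\<close> outside \<open>{1..n}\<close> are irrelevant.
\<close>

type_synonym rvec = "nat \<Rightarrow>\<^sub>0 real"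

definition Rspace :: "nat \<Rightarrow> rvec set" where
  "Rspace d = {v. Poly_Mapping.keys v \<subseteq> {1..d}}"

definition partial_sum :: "(nat \<Rightarrow> rvec) \<Rightarrow> nat \<Rightarrow> rvec" where
  "partial_sum x k = (\<Sum>i = 1..k. x i)"

text \<open>
  Linear independence of \<open>d\<close> vectors is that of an indexed family, so a repeated vector makes
  the family dependent; \<^const>\<open>independent\<close> alone only sees the set of values.
\<close>

definition any_independent :: "nat \<Rightarrow> nat \<Rightarrow> (nat \<Rightarrow> rvec) \<Rightarrow> bool" where
  "any_independent d m v \<longleftrightarrow>
     (\<forall>I \<subseteq> {1..m}. card I = d \<longrightarrow> inj_on v I \<and> independent (v ` I))"

definition hull_contains_zero :: "nat \<Rightarrow> (nat \<Rightarrow> rvec) \<Rightarrow> bool" where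
  "hull_contains_zero m v \<longleftrightarrow> 0 \<in> convex hull (v ` {1..m})"

text \<open>Sign vectors are restricted to \<open>{1..n}\<close>, so that there are exactly \<open>2 ^ n\<close> of them.\<close>

definition signs :: "nat \<Rightarrow> (nat \<Rightarrow> real) set" where
  "signs n = {1..n} \<rightarrow>\<^sub>E {-1, 1}"

definition signed_perms :: "nat \<Rightarrow> ((nat \<Rightarrow> nat) \<times> (nat \<Rightarrow> real)) set" where
  "signed_perms n = {\<sigma>. \<sigma> permutes {1..n}} \<times> signs n"

definition signed_perm_act ::
    "(nat \<Rightarrow> nat) \<times> (nat \<Rightarrow> real) \<Rightarrow> (nat \<Rightarrow> rvec) \<Rightarrow> nat \<Rightarrow> rvec" where
  "signed_perm_act g x = (\<lambda>i. snd g i *\<^sub>R x (fst g i))"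


definition wendel_regular :: "nat \<Rightarrow> nat \<Rightarrow> (nat \<Rightarrow> rvec) \<Rightarrow> bool" where
  "wendel_regular n d x \<longleftrightarrow> x ` {1..n} \<subseteq> Rspace d \<and> any_independent d n x"

definition wendel_count :: "nat \<Rightarrow> (nat \<Rightarrow> rvec) \<Rightarrow> nat" where
  "wendel_count n x = card {\<epsilon> \<in> signs n. hull_contains_zero n (\<lambda>i. \<epsilon> i *\<^sub>R x i)}"

definition walk_regular :: "nat \<Rightarrow> nat \<Rightarrow> (nat \<Rightarrow> rvec) \<Rightarrow> bool" where
  "walk_regular n d x \<longleftrightarrow> x ` {1..n} \<subseteq> Rspace d \<and>
     (\<forall>g \<in> signed_perms n. any_independent d n (partial_sum (signed_perm_act g x)))"

definition walk_count :: "nat \<Rightarrow> (nat \<Rightarrow> rvec) \<Rightarrow> nat" where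
  "walk_count n x =
     card {g \<in> signed_perms n. hull_contains_zero n (partial_sum (signed_perm_act g x))}"

definition bridge_regular :: "nat \<Rightarrow> nat \<Rightarrow> (nat \<Rightarrow> rvec) \<Rightarrow> bool" where
  "bridge_regular n d x \<longleftrightarrow> x ` {1..n} \<subseteq> Rspace d \<and> partial_sum x n = 0 \<and>
     (\<forall>\<sigma>. \<sigma> permutes {1..n} \<longrightarrow> any_independent d (n - 1) (partial_sum (x \<circ> \<sigma>)))"

definition bridge_count :: "nat \<Rightarrow> (nat \<Rightarrow> rvec) \<Rightarrow> nat" where
  "bridge_count n x =
     card {\<sigma>. \<sigma> permutes {1..n} \<and> hull_contains_zero (n - 1) (partial_sum (x \<circ> \<sigma>))}"

text \<open>
  In the range of each model the number is the common value of the counts of all regular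
  configurations; the first two branches are the boundary conventions. The arguments are in the
  order \<open>n\<close>, \<open>d\<close>. The values are only meaningful for \<open>n \<ge> 1\<close>, \<open>d \<le> n\<close> (Wendel, walk) and for
  \<open>n \<ge> 2\<close>, \<open>d \<le> n - 1\<close> (bridge).
\<close>

definition N_Wend :: "nat \<Rightarrow> nat \<Rightarrow> nat" where
  "N_Wend n d =
     (if d = 0 then 2 ^ n
      else if n = d then 0
      else (THE N. \<forall>x. wendel_regular n d x \<longrightarrow> wendel_count n x = N))"

definition N_walk :: "nat \<Rightarrow> nat \<Rightarrow> nat" where
  "N_walk n d =
     (if d = 0 then 2 ^ n * fact n
      else if n = d then 0
      else (THE N. \<forall>x. walk_regular n d x \<longrightarrow> walk_count n x = N))"

definition N_br :: "nat \<Rightarrow> nat \<Rightarrow> nat" where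
  "N_br n d =
     (if d = 0 then fact n
      else if n = d + 1 then 0
      else (THE N. \<forall>x. bridge_regular n d x \<longrightarrow> bridge_count n x = N))"

end

(*
  Summation by parts turns 0 in Conv(s_1(gX), ..., s_m(gX)) into the existence of a nonzero vector in
  the kernel of X that lies in the closed chamber of g, where the chambers are those of the
  coordinate arrangement (Wendel), of the reflection arrangement B_n (walk) or A_{n-1} (bridge).
  Regularity puts the kernel in general position, so the chamber can be taken open, and the number is
  the number of regions that the arrangement induces on the kernel.

  These regions are counted by deletion-restriction. Remove all hyperplanes that involve the last
  coordinate (1, 2n - 1 and n - 1 of them, respectively). What remains on the kernel is the situation
  for n - 1 and d - 1, via the projection forgetting the last coordinate; the restriction to each
  removed hyperplane is the situation for n - 1 and d. Since the recursion holds for every kernel in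
  general position, it also shows that the number does not depend on X.
*)

theory Submission
  imports Defs
begin

subsection \<open>Regions of an arrangement\<close>

text \<open>All three arrangements are graded by a coordinate index, and where one functional of an
  index vanishes, the others of that index reduce to functionals of smaller index. So a point
  satisfies at most one new equation per index, and the dimension of its flat is the number of
  indices at which no functional vanishes. The obstacle is the induction: restriction merges columns
  and projection eliminates one, and independence of partial sums is awkward to follow through this.
  It is therefore converted once into a gap in the possible dimensions of flats of kernel vectors,
  which survives both operations. Every hyperplane of the bridge arrangement contains the constant
  vectors; the parameter \<open>off\<close>, 0 or 1, absorbs this difference. Equality of all counts
  does not yet determine the numbers, which are definite descriptions: a regular configuration has
  to exist. It is the image of unit vectors of dimension n (centred ones for bridges) under a linear
  map into dimension d, given by evaluating polynomials at generic points.\<close>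

text \<open>A region is encoded by the set of functionals that are positive on it.\<close>

definition regions :: "('r \<Rightarrow> 'a \<Rightarrow> real) \<Rightarrow> 'a set \<Rightarrow> 'r set \<Rightarrow> 'r set set" where
  "regions ev A F = (\<lambda>c. {r \<in> F. ev r c > 0}) ` {c \<in> A. \<forall>r\<in>F. ev r c \<noteq> 0}"

lemma regionsI: "c \<in> A \<Longrightarrow> \<forall>r\<in>F. ev r c \<noteq> 0 \<Longrightarrow> {r \<in> F. ev r c > 0} \<in> regions ev A F"
  by (auto simp: regions_def)

lemma regionsE:
  assumes "S \<in> regions ev A F"
  obtains c where "c \<in> A" "\<forall>r\<in>F. ev r c \<noteq> 0" "S = {r \<in> F. ev r c > 0}"
  using assms by (auto simp: regions_def)

lemma regions_cong:
  assumes "\<And>a. a \<in> A \<Longrightarrow> \<exists>b\<in>B. \<forall>r\<in>F. ev r b = ev r a"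
    and "\<And>b. b \<in> B \<Longrightarrow> \<exists>a\<in>A. \<forall>r\<in>F. ev r a = ev r b"
  shows "regions ev A F = regions ev B F"
proof -
  have *: "regions ev A' F \<subseteq> regions ev B' F"
    if h: "\<And>a. a \<in> A' \<Longrightarrow> \<exists>b\<in>B'. \<forall>r\<in>F. ev r b = ev r a" for A' B'
  proof
    fix S assume "S \<in> regions ev A' F"
    then obtain a where a: "a \<in> A'" "\<forall>r\<in>F. ev r a \<noteq> 0" "S = {r \<in> F. ev r a > 0}"
      by (rule regionsE)
    obtain b where b: "b \<in> B'" "\<forall>r\<in>F. ev r b = ev r a" using h a by blast
    have "S = {r \<in> F. ev r b > 0}" using a b by auto
    then show "S \<in> regions ev B' F" using a b regionsI[of b B' F ev] by auto
  qed
  show ?thesis using *[of A B] *[of B A] assms by (simp add: subset_antisym)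
qed

text \<open>The same estimate serves for pushing a point off a hyperplane without crossing the
  others and for adding a vector to a positive relation without spoiling positivity.\<close>

lemma small_perturbation:
  fixes u v :: "'r \<Rightarrow> real"
  assumes "finite F" "\<forall>r\<in>F. u r \<noteq> 0"
  obtains \<delta> where "\<delta> > 0" "\<forall>r\<in>F. \<bar>\<delta> * v r\<bar> < \<bar>u r\<bar>"
proof -
  have "\<exists>\<delta>>0. \<forall>r\<in>F. \<bar>\<delta> * v r\<bar> < \<bar>u r\<bar>"
    using assms
  proof (induction F)
    case empty
    show ?case by (rule exI[of _ 1]) auto
  next
    case (insert q F)
    then obtain \<delta> where d: "\<delta> > 0" "\<forall>r\<in>F. \<bar>\<delta> * v r\<bar> < \<bar>u r\<bar>" by auto
    \<comment> \<open>Adding 1 in the denominator covers \<open>v q = 0\<close> and makes the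
      inequality strict.\<close>
    define e where "e = \<bar>u q\<bar> / (\<bar>v q\<bar> + 1)"
    have e: "e > 0" using insert.prems by (auto simp: e_def)
    have eq: "e * \<bar>v q\<bar> < \<bar>u q\<bar>"
      using insert.prems by (auto simp: e_def field_simps)
    let ?m = "min \<delta> e"
    have "\<bar>?m * v q\<bar> < \<bar>u q\<bar>"
    proof -
      have "\<bar>?m * v q\<bar> = ?m * \<bar>v q\<bar>" using d e by (simp add: abs_mult)
      also have "\<dots> \<le> e * \<bar>v q\<bar>" by (intro mult_right_mono) auto
      finally show ?thesis using eq by simp
    qed
    moreover have "\<bar>?m * v r\<bar> < \<bar>u r\<bar>" if "r \<in> F" for r
    proof -
      have "\<bar>?m * v r\<bar> = ?m * \<bar>v r\<bar>" using d e by (simp add: abs_mult)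
      also have "\<dots> \<le> \<delta> * \<bar>v r\<bar>" by (intro mult_right_mono) auto
      also have "\<dots> = \<bar>\<delta> * v r\<bar>" using d by (simp add: abs_mult)
      finally show ?thesis using d that by auto
    qed
    ultimately show ?case using d e by (intro exI[of _ ?m]) auto
  qed
  with that show thesis by blast
qed

text \<open>The points form an arbitrary type without vector space operations, so linearity is
  demanded only of what the functionals can see.\<close>

definition combination_closed :: "('r \<Rightarrow> 'a \<Rightarrow> real) \<Rightarrow> 'a set \<Rightarrow> bool" where
  "combination_closed ev A \<longleftrightarrow>
     (\<forall>a\<in>A. \<forall>b\<in>A. \<forall>s t. \<exists>c\<in>A. \<forall>r. ev r c = s * ev r a + t * ev r b)"

text \<open>
  Regions of the smaller arrangement are cut by the new hyperplane exactly when they meet it: let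
  \<open>P\<close> and \<open>Q\<close> be the regions with a point on the positive and on the negative side; then
  \<open>P \<union> Q\<close> are all old regions and \<open>P \<inter> Q\<close> the regions of the restriction.
\<close>

lemma card_regions_insert:
  assumes fin: "finite F" and g: "g \<notin> F" and A: "combination_closed ev A"
    and a0: "a0 \<in> A" "ev g a0 \<noteq> 0"
  shows "card (regions ev A (insert g F)) =
         card (regions ev A F) + card (regions ev {c \<in> A. ev g c = 0} F)"
proof -
  let ?sg = "\<lambda>c. {r \<in> F. ev r c > 0}"
  define P where "P = ?sg ` {c \<in> A. (\<forall>r\<in>F. ev r c \<noteq> 0) \<and> ev g c > 0}"
  define Q where "Q = ?sg ` {c \<in> A. (\<forall>r\<in>F. ev r c \<noteq> 0) \<and> ev g c < 0}"
  have finP: "finite P" "finite Q"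
    unfolding P_def Q_def by (rule finite_subset[of _ "Pow F"]; use fin in auto)+
  have gP: "g \<notin> S" if "S \<in> P \<union> Q" for S using that g by (auto simp: P_def Q_def)
  \<comment> \<open>Moving \<open>c\<close> by a small positive or negative multiple of
    \<open>a0\<close> changes no sign on \<open>F\<close> but reaches both sides of
    \<open>g\<close>.\<close>
  have perturb: "?sg c \<in> P \<inter> Q" if c: "c \<in> A" "\<forall>r\<in>F. ev r c \<noteq> 0" "ev g c = 0" for c
  proof -
    obtain \<delta> where d: "\<delta> > 0" "\<forall>r\<in>F. \<bar>\<delta> * ev r a0\<bar> < \<bar>ev r c\<bar>"
      using small_perturbation[OF fin c(2), of "\<lambda>r. ev r a0"] by blast
    have side: "\<exists>b\<in>A. (\<forall>r\<in>F. ev r b \<noteq> 0) \<and> ?sg b = ?sg c \<and> ev g b = s * ev g a0"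
      if s: "\<bar>s\<bar> = \<delta>" for s
    proof -
      obtain b where b: "b \<in> A" "\<forall>r. ev r b = 1 * ev r c + s * ev r a0"
        using A c(1) a0(1) unfolding combination_closed_def by blast
      have "\<bar>s * ev r a0\<bar> < \<bar>ev r c\<bar>" if "r \<in> F" for r
        using d that s by (simp add: abs_mult)
      then have "ev r b \<noteq> 0 \<and> (ev r b > 0 \<longleftrightarrow> ev r c > 0)" if "r \<in> F" for r
        using b(2) that by (smt (verit, best))
      then show ?thesis using b c(3) by (intro bexI[of _ b]) auto
    qed
    obtain b1 where b1: "b1 \<in> A" "\<forall>r\<in>F. ev r b1 \<noteq> 0" "?sg b1 = ?sg c" "ev g b1 = \<delta> * ev g a0"
      using side[of \<delta>] d by auto
    obtain b2 where b2: "b2 \<in> A" "\<forall>r\<in>F. ev r b2 \<noteq> 0" "?sg b2 = ?sg c" "ev g b2 = - \<delta> * ev g a0"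
      using side[of "- \<delta>"] d by auto
    have sgn: "(ev g b1 > 0 \<and> ev g b2 < 0) \<or> (ev g b1 < 0 \<and> ev g b2 > 0)"
      using b1(4) b2(4) d(1) a0(2) by (simp add: zero_less_mult_iff mult_less_0_iff) linarith
    show ?thesis
    proof (cases "ev g b1 > 0")
      case True
      then have "?sg b1 \<in> P" "?sg b2 \<in> Q" using b1 b2 sgn unfolding P_def Q_def by auto
      then show ?thesis using b1(3) b2(3) by simp
    next
      case False
      then have "?sg b1 \<in> Q" "?sg b2 \<in> P" using b1 b2 sgn unfolding P_def Q_def by auto
      then show ?thesis using b1(3) b2(3) by simp
    qed
  qed
  have un: "P \<union> Q = regions ev A F"
  proof
    show "P \<union> Q \<subseteq> regions ev A F" by (auto simp: P_def Q_def regions_def)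
    show "regions ev A F \<subseteq> P \<union> Q"
    proof
      fix S assume "S \<in> regions ev A F"
      then obtain c where c: "c \<in> A" "\<forall>r\<in>F. ev r c \<noteq> 0" "S = ?sg c" by (rule regionsE)
      consider "ev g c = 0" | "ev g c > 0" | "ev g c < 0" by linarith
      then show "S \<in> P \<union> Q"
        by cases (use c perturb in \<open>auto simp: P_def Q_def\<close>)
    qed
  qed
  have int: "P \<inter> Q = regions ev {c \<in> A. ev g c = 0} F"
  proof
    show "regions ev {c \<in> A. ev g c = 0} F \<subseteq> P \<inter> Q"
      using perturb by (auto elim!: regionsE)
    show "P \<inter> Q \<subseteq> regions ev {c \<in> A. ev g c = 0} F"
    proof
      fix S assume "S \<in> P \<inter> Q"
      then obtain a b where a: "a \<in> A" "\<forall>r\<in>F. ev r a \<noteq> 0" "ev g a > 0" "S = ?sg a"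
        and b: "b \<in> A" "\<forall>r\<in>F. ev r b \<noteq> 0" "ev g b < 0" "S = ?sg b"
        unfolding P_def Q_def by auto
      \<comment> \<open>Both weights are positive and the value of \<open>g\<close> cancels: up to
        scaling, this is where the segment from \<open>a\<close> to \<open>b\<close> meets the
        hyperplane.\<close>
      obtain c where c: "c \<in> A" "\<forall>r. ev r c = (- ev g b) * ev r a + ev g a * ev r b"
        using A a(1) b(1) unfolding combination_closed_def by blast
      have "ev r c \<noteq> 0 \<and> (ev r c > 0 \<longleftrightarrow> ev r a > 0)" if r: "r \<in> F" for r
      proof (cases "ev r a > 0")
        case True
        then have "ev r b > 0" using r a(4) b(4) by blast
        then have "ev r c > 0" using c(2) a(3) b(3) True
          by (metis add_pos_pos mult_pos_pos neg_0_less_iff_less)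
        then show ?thesis using True by simp
      next
        case False
        then have na: "ev r a < 0" using a(2) r by force
        have "\<not> ev r b > 0" using r a(4) b(4) False by blast
        then have "ev r b < 0" using b(2) r by force
        then have "ev r c < 0" using c(2) a(3) b(3) na
          by (metis add_neg_neg mult_pos_neg neg_0_less_iff_less)
        then show ?thesis using False by simp
      qed
      then have "S = ?sg c" "\<forall>r\<in>F. ev r c \<noteq> 0" using a(4) by auto
      moreover have "ev g c = 0" using c(2)[rule_format, of g] by simp
      ultimately show "S \<in> regions ev {c \<in> A. ev g c = 0} F"
        using regionsI[of c "{c \<in> A. ev g c = 0}" F ev] c(1) by simp
    qed
  qed
  \<comment> \<open>A region on the positive side carries \<open>g\<close> in its sign set and one
    on the negative side does not, so the two kinds are counted by
    \<open>card P + card Q\<close>.\<close>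
  have split: "regions ev A (insert g F) = insert g ` P \<union> Q"
  proof
    show "regions ev A (insert g F) \<subseteq> insert g ` P \<union> Q"
    proof
      fix S assume "S \<in> regions ev A (insert g F)"
      then obtain c where c: "c \<in> A" "\<forall>r\<in>insert g F. ev r c \<noteq> 0"
        "S = {r \<in> insert g F. ev r c > 0}" by (rule regionsE)
      show "S \<in> insert g ` P \<union> Q"
      proof (cases "ev g c > 0")
        case True
        then have "S = insert g (?sg c)" "?sg c \<in> P" using c by (auto simp: P_def)
        then show ?thesis by blast
      next
        case False
        then have "ev g c < 0" using c by force
        then have "S = ?sg c" "?sg c \<in> Q" using c by (auto simp: Q_def)
        then show ?thesis by blast
      qed
    qed
    show "insert g ` P \<union> Q \<subseteq> regions ev A (insert g F)"
    proof
      fix S assume "S \<in> insert g ` P \<union> Q"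
      then consider c where "c \<in> A" "\<forall>r\<in>F. ev r c \<noteq> 0" "ev g c > 0" "S = insert g (?sg c)"
        | c where "c \<in> A" "\<forall>r\<in>F. ev r c \<noteq> 0" "ev g c < 0" "S = ?sg c"
        unfolding P_def Q_def by blast
      then show "S \<in> regions ev A (insert g F)"
      proof cases
        case 1
        then have "S = {r \<in> insert g F. ev r c > 0}" by auto
        then show ?thesis using 1 regionsI[of c A "insert g F" ev] by auto
      next
        case 2
        then have "S = {r \<in> insert g F. ev r c > 0}" by auto
        then show ?thesis using 2 regionsI[of c A "insert g F" ev] by auto
      qed
    qed
  qed
  have disj: "insert g ` P \<inter> Q = {}" using gP by auto
  have inj: "inj_on (insert g) P" using gP by (intro inj_onI) (metis Un_iff insert_ident)
  have "card (regions ev A (insert g F)) = card P + card Q"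
    unfolding split using disj inj finP by (simp add: card_Un_disjoint card_image)
  also have "\<dots> = card (P \<union> Q) + card (P \<inter> Q)"
    using finP by (rule card_Un_Int)
  finally show ?thesis by (simp add: un int)
qed

text \<open>The sign of a functional proportional to some \<open>r0\<close> in \<open>F\<close> is
  forced by the sign of \<open>r0\<close>, so intersecting a sign set with \<open>F\<close> loses no
  information.\<close>

lemma card_regions_redundant:
  assumes sub: "F \<subseteq> F'"
    and scaled: "\<And>r. r \<in> F' \<Longrightarrow> \<exists>r0\<in>F. \<exists>s. s \<noteq> 0 \<and> (\<forall>c\<in>A. ev r c = s * ev r0 c)"
  shows "card (regions ev A F') = card (regions ev A F)"
proof -
  have nz: "\<forall>r\<in>F'. ev r c \<noteq> 0" if "\<forall>r\<in>F. ev r c \<noteq> 0" "c \<in> A" for c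
    using scaled that by (metis mult_eq_0_iff)
  have eq: "{r \<in> F'. ev r a > 0} = {r \<in> F'. ev r b > 0}"
    if "a \<in> A" "b \<in> A" "\<forall>r\<in>F'. ev r a \<noteq> 0" "\<forall>r\<in>F'. ev r b \<noteq> 0"
      "{r \<in> F. ev r a > 0} = {r \<in> F. ev r b > 0}" for a b
  proof -
    have "ev r a > 0 \<longleftrightarrow> ev r b > 0" if r: "r \<in> F'" for r
    proof -
      obtain r0 s where p: "r0 \<in> F" "s \<noteq> 0" "ev r a = s * ev r0 a" "ev r b = s * ev r0 b"
        using scaled[OF r] \<open>a \<in> A\<close> \<open>b \<in> A\<close> by blast
      have "ev r0 a > 0 \<longleftrightarrow> ev r0 b > 0" using that p(1)
        \<open>{r \<in> F. ev r a > 0} = {r \<in> F. ev r b > 0}\<close> by blast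
      moreover have "ev r0 a \<noteq> 0" "ev r0 b \<noteq> 0"
        using p(1) sub \<open>\<forall>r\<in>F'. ev r a \<noteq> 0\<close> \<open>\<forall>r\<in>F'. ev r b \<noteq> 0\<close> by auto
      ultimately show ?thesis unfolding p(3,4) using p(2)
        by (auto simp: zero_less_mult_iff)
    qed
    then show ?thesis by auto
  qed
  have inj: "inj_on (\<lambda>S. S \<inter> F) (regions ev A F')"
  proof (rule inj_onI)
    fix S T assume S: "S \<in> regions ev A F'" and T: "T \<in> regions ev A F'" and ST: "S \<inter> F = T \<inter> F"
    obtain a where a: "a \<in> A" "\<forall>r\<in>F'. ev r a \<noteq> 0" "S = {r \<in> F'. ev r a > 0}"
      using S by (rule regionsE)
    obtain b where b: "b \<in> A" "\<forall>r\<in>F'. ev r b \<noteq> 0" "T = {r \<in> F'. ev r b > 0}"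
      using T by (rule regionsE)
    have "{r \<in> F. ev r a > 0} = S \<inter> F" "{r \<in> F. ev r b > 0} = T \<inter> F"
      using a b sub by auto
    then show "S = T" using eq[OF a(1) b(1) a(2) b(2)] a(3) b(3) ST by simp
  qed
  have "(\<lambda>S. S \<inter> F) ` regions ev A F' = regions ev A F"
  proof
    show "(\<lambda>S. S \<inter> F) ` regions ev A F' \<subseteq> regions ev A F"
    proof
      fix T assume "T \<in> (\<lambda>S. S \<inter> F) ` regions ev A F'"
      then obtain a where a: "a \<in> A" "\<forall>r\<in>F'. ev r a \<noteq> 0" "T = {r \<in> F'. ev r a > 0} \<inter> F"
        by (auto elim!: regionsE)
      have "T = {r \<in> F. ev r a > 0}" using a(3) sub by auto
      then show "T \<in> regions ev A F" using a sub regionsI[of a A F ev] by auto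
    qed
    show "regions ev A F \<subseteq> (\<lambda>S. S \<inter> F) ` regions ev A F'"
    proof
      fix T assume "T \<in> regions ev A F"
      then obtain a where a: "a \<in> A" "\<forall>r\<in>F. ev r a \<noteq> 0" "T = {r \<in> F. ev r a > 0}"
        by (rule regionsE)
      have "T = {r \<in> F'. ev r a > 0} \<inter> F" using a(3) sub by auto
      moreover have "{r \<in> F'. ev r a > 0} \<in> regions ev A F'"
        using a nz by (intro regionsI) auto
      ultimately show "T \<in> (\<lambda>S. S \<inter> F) ` regions ev A F'" by blast
    qed
  qed
  then show ?thesis using inj card_image by metis
qed

text \<open>The members of \<open>G\<close> are inserted one at a time. On the hyperplane of the
  newest one, those inserted earlier are proportional to members of \<open>F\<close>, so each
  summand sees the restriction of \<open>F\<close> alone.\<close>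

lemma card_regions_union:
  assumes fin: "finite F" "finite G" and disj: "F \<inter> G = {}" and A: "combination_closed ev A"
    and nonzero: "\<And>g. g \<in> G \<Longrightarrow> \<exists>a\<in>A. ev g a \<noteq> 0"
    and scaled: "\<And>g h. g \<in> G \<Longrightarrow> h \<in> G \<Longrightarrow> g \<noteq> h \<Longrightarrow>
       \<exists>r\<in>F. \<exists>s. s \<noteq> 0 \<and> (\<forall>c\<in>A. ev g c = 0 \<longrightarrow> ev h c = s * ev r c)"
  shows "card (regions ev A (G \<union> F)) =
         card (regions ev A F) + (\<Sum>g\<in>G. card (regions ev {c \<in> A. ev g c = 0} F))"
  using fin(2) disj nonzero scaled
proof (induction G)
  case empty
  then show ?case by simp
next
  case (insert g G)
  obtain a where a: "a \<in> A" "ev g a \<noteq> 0" using insert.prems by blast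
  have "card (regions ev A (insert g (G \<union> F))) =
      card (regions ev A (G \<union> F)) + card (regions ev {c \<in> A. ev g c = 0} (G \<union> F))"
    using fin insert.hyps insert.prems(1) A a by (intro card_regions_insert) auto
  also have "card (regions ev {c \<in> A. ev g c = 0} (G \<union> F)) =
      card (regions ev {c \<in> A. ev g c = 0} F)"
  proof (rule card_regions_redundant)
    fix r assume r: "r \<in> G \<union> F"
    show "\<exists>r0\<in>F. \<exists>s. s \<noteq> 0 \<and> (\<forall>c\<in>{c \<in> A. ev g c = 0}. ev r c = s * ev r0 c)"
    proof (cases "r \<in> F")
      case True
      then show ?thesis by (intro bexI[of _ r] exI[of _ 1]) auto
    next
      case False
      then have "\<exists>r0\<in>F. \<exists>s. s \<noteq> 0 \<and> (\<forall>c\<in>A. ev g c = 0 \<longrightarrow> ev r c = s * ev r0 c)"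
        using insert.hyps r by (intro insert.prems(3)) auto
      then show ?thesis by (simp add: Ball_def imp_conjL)
    qed
  qed auto
  also have "card (regions ev A (G \<union> F)) =
      card (regions ev A F) + (\<Sum>g\<in>G. card (regions ev {c \<in> A. ev g c = 0} F))"
    using insert.prems by (intro insert.IH) auto
  finally show ?case using insert.hyps by simp
qed

subsection \<open>Root families\<close>

text \<open>
  The index \<open>(i, j)\<close> stands for the hyperplane \<open>c\<^sub>i = c\<^sub>j\<close>, \<open>c\<^sub>i = - c\<^sub>-\<^sub>j\<close> or \<open>c\<^sub>i = 0\<close>
  according to whether \<open>j\<close> is positive, negative or zero.
\<close>

definition signed_entry :: "(nat \<Rightarrow> real) \<Rightarrow> int \<Rightarrow> real" where
  "signed_entry c j = of_int (sgn j) * c (nat \<bar>j\<bar>)"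

definition root_eval :: "nat \<times> int \<Rightarrow> (nat \<Rightarrow> real) \<Rightarrow> real" where
  "root_eval r c = c (fst r) - signed_entry c (snd r)"

lemma signed_entry_simps [simp]:
  "signed_entry c 0 = 0"
  "i > 0 \<Longrightarrow> signed_entry c (int i) = c i"
  "signed_entry c (- j) = - signed_entry c j"
  by (auto simp: signed_entry_def)

lemma signed_entry_cong: "c (nat \<bar>j\<bar>) = c' (nat \<bar>j\<bar>) \<Longrightarrow> signed_entry c j = signed_entry c' j"
  by (simp add: signed_entry_def)

lemma root_eval_combination:
  "root_eval r (\<lambda>i. s * a i + t * b i) = s * root_eval r a + t * root_eval r b"
  by (simp add: root_eval_def signed_entry_def algebra_simps)

section \<open>Solution spaces of linear systems\<close>

definition kernel_space :: "nat \<Rightarrow> nat set \<Rightarrow> (nat \<Rightarrow> nat \<Rightarrow> real) \<Rightarrow> (nat \<Rightarrow> real) set" where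
  "kernel_space n K M = {c. \<forall>k\<in>K. (\<Sum>i=1..n. c i * M k i) = 0}"

lemma kernel_space_combination:
  assumes "a \<in> kernel_space n K M" "b \<in> kernel_space n K M"
  shows "(\<lambda>i. s * a i + t * b i) \<in> kernel_space n K M"
proof -
  have "(\<Sum>i=1..n. (s * a i + t * b i) * M k i) = 0" if "k \<in> K" for k
  proof -
    have "(\<Sum>i=1..n. (s * a i + t * b i) * M k i) =
        s * (\<Sum>i=1..n. a i * M k i) + t * (\<Sum>i=1..n. b i * M k i)"
      by (simp add: sum_distrib_left sum.distrib algebra_simps)
    then show ?thesis using assms that by (simp add: kernel_space_def)
  qed
  then show ?thesis by (simp add: kernel_space_def)
qed

lemma combination_closed_kernel_space: "combination_closed root_eval (kernel_space n K M)"
  unfolding combination_closed_def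
proof (intro ballI allI)
  fix a b s t assume "a \<in> kernel_space n K M" "b \<in> kernel_space n K M"
  then show "\<exists>c\<in>kernel_space n K M. \<forall>r. root_eval r c = s * root_eval r a + t * root_eval r b"
    by (intro bexI[OF _ kernel_space_combination[of a n K M b s t]])
       (auto simp: root_eval_combination)
qed

text \<open>Gaussian elimination within a prescribed support. It yields both kernel vectors of small
  rank and linear relations among \<open>d + 1\<close> vectors of dimension
  \<open>d\<close>.\<close>

lemma underdetermined_system:
  fixes M :: "nat \<Rightarrow> 'i \<Rightarrow> real"
  assumes "finite K" "finite S" "card S > card K"
  obtains c where "\<forall>i. i \<notin> S \<longrightarrow> c i = 0" "\<exists>i\<in>S. c i \<noteq> 0" "\<forall>k\<in>K. (\<Sum>i\<in>S. c i * M k i) = 0"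
proof -
  have "\<exists>c. (\<forall>i. i \<notin> S \<longrightarrow> c i = 0) \<and> (\<exists>i\<in>S. c i \<noteq> 0) \<and> (\<forall>k\<in>K. (\<Sum>i\<in>S. c i * M k i) = 0)"
    using assms
  proof (induction K arbitrary: S M)
    case empty
    then have "S \<noteq> {}" by auto
    then show ?case by (intro exI[of _ "\<lambda>i. if i \<in> S then 1 else 0"]) auto
  next
    case (insert p K)
    show ?case
    proof (cases "\<forall>i\<in>S. M p i = 0")
      case True
      obtain c where "\<forall>i. i \<notin> S \<longrightarrow> c i = 0" "\<exists>i\<in>S. c i \<noteq> 0" "\<forall>k\<in>K. (\<Sum>i\<in>S. c i * M k i) = 0"
        using insert.IH[of S M] insert.prems insert.hyps by auto
      then show ?thesis using True by (intro exI[of _ c]) auto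
    next
      case False
      then obtain q where q: "q \<in> S" "M p q \<noteq> 0" by blast
      define T where "T = S - {q}"
      have T: "finite T" "q \<notin> T" "S = insert q T" "card T > card K"
        using insert.prems insert.hyps q by (auto simp: T_def)
      \<comment> \<open>The pivot equation \<open>p\<close> removes the unknown \<open>q\<close>
        from the other equations; \<open>e\<close> below is the value of \<open>q\<close> that then
        solves \<open>p\<close>.\<close>
      obtain c where c: "\<forall>i. i \<notin> T \<longrightarrow> c i = 0" "\<exists>i\<in>T. c i \<noteq> 0"
        "\<forall>k\<in>K. (\<Sum>i\<in>T. c i * (M k i - M k q / M p q * M p i)) = 0"
        using insert.IH[of T "\<lambda>k i. M k i - M k q / M p q * M p i"] T by auto
      define e where "e = - (\<Sum>i\<in>T. c i * M p i) / M p q"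
      let ?c = "c(q := e)"
      have sum: "(\<Sum>i\<in>S. ?c i * M k i) = e * M k q + (\<Sum>i\<in>T. c i * M k i)" for k
      proof -
        have "(\<Sum>i\<in>T. ?c i * M k i) = (\<Sum>i\<in>T. c i * M k i)"
          using T(2) by (intro sum.cong) auto
        then show ?thesis using T by simp
      qed
      have "(\<Sum>i\<in>S. ?c i * M p i) = 0" unfolding sum using q by (simp add: e_def)
      moreover have "(\<Sum>i\<in>S. ?c i * M k i) = 0" if "k \<in> K" for k
      proof -
        have "(\<Sum>i\<in>T. c i * M k i) - M k q / M p q * (\<Sum>i\<in>T. c i * M p i) = 0"
          using c(3) that by (simp add: algebra_simps sum_subtractf sum_distrib_left)
        then show ?thesis unfolding sum by (simp add: e_def algebra_simps)
      qed
      moreover have "\<forall>i. i \<notin> S \<longrightarrow> ?c i = 0" "\<exists>i\<in>S. ?c i \<noteq> 0" using c(1,2) T by auto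
      ultimately show ?thesis by (intro exI[of _ ?c]) auto
    qed
  qed
  with that show thesis by blast
qed

text \<open>With \<open>p\<close> as pivot the last coordinate is a function of the others. The
  smaller kernel reads only \<open>{1..n}\<close>, so \<open>c\<close> is its own projection, and
  the update at \<open>Suc n\<close> is the way back.\<close>

lemma kernel_space_eliminate_last:
  assumes p: "p \<in> K" "M p (Suc n) \<noteq> 0"
    and M': "\<And>k i. M' k i = M k i - M k (Suc n) / M p (Suc n) * M p i"
  shows "c \<in> kernel_space (Suc n) K M \<Longrightarrow> c \<in> kernel_space n (K - {p}) M'"
    and "b \<in> kernel_space n (K - {p}) M' \<Longrightarrow>
      b(Suc n := - (\<Sum>i=1..n. b i * M p i) / M p (Suc n)) \<in> kernel_space (Suc n) K M"
proof -
  have sum': "(\<Sum>i=1..n. c i * M' k i) =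
      (\<Sum>i=1..n. c i * M k i) - M k (Suc n) / M p (Suc n) * (\<Sum>i=1..n. c i * M p i)" for c k
    by (simp add: M' algebra_simps sum_subtractf sum_distrib_left)
  show "c \<in> kernel_space n (K - {p}) M'" if c: "c \<in> kernel_space (Suc n) K M"
  proof -
    have *: "(\<Sum>i=1..n. c i * M k i) = - c (Suc n) * M k (Suc n)" if "k \<in> K" for k
    proof -
      have "(\<Sum>i=1..n. c i * M k i) + c (Suc n) * M k (Suc n) = 0"
        using c that by (auto simp: kernel_space_def)
      then show ?thesis by simp
    qed
    have "(\<Sum>i=1..n. c i * M' k i) = 0" if "k \<in> K" for k
      unfolding sum' *[OF that] *[OF p(1)] using p(2) by simp
    then show ?thesis by (simp add: kernel_space_def)
  qed
  show "b(Suc n := - (\<Sum>i=1..n. b i * M p i) / M p (Suc n)) \<in> kernel_space (Suc n) K M"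
    if b: "b \<in> kernel_space n (K - {p}) M'"
  proof -
    let ?e = "- (\<Sum>i=1..n. b i * M p i) / M p (Suc n)"
    have sum: "(\<Sum>i=1..Suc n. (b(Suc n := ?e)) i * M k i) = (\<Sum>i=1..n. b i * M k i) + ?e * M k (Suc n)" for k
    proof -
      have "(\<Sum>i=1..n. (b(Suc n := ?e)) i * M k i) = (\<Sum>i=1..n. b i * M k i)"
        by (intro sum.cong) auto
      then show ?thesis by simp
    qed
    have "(\<Sum>i=1..Suc n. (b(Suc n := ?e)) i * M k i) = 0" if k: "k \<in> K" for k
    proof (cases "k = p")
      case True
      then show ?thesis unfolding sum using p by simp
    next
      case False
      then have "(\<Sum>i=1..n. b i * M' k i) = 0" using b k by (auto simp: kernel_space_def)
      then show ?thesis unfolding sum sum' by (simp add: algebra_simps)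
    qed
    then show ?thesis by (simp add: kernel_space_def)
  qed
qed

text \<open>
  The set \<open>J i\<close> lists the hyperplanes that involve the coordinate \<open>i\<close> and smaller ones. The closure
  condition says that on one hyperplane of index \<open>i\<close> all others become hyperplanes of smaller index,
  so that restricting the arrangement of size \<open>n\<close> to a hyperplane of index \<open>n\<close> gives the one of
  size \<open>n - 1\<close>. The number \<open>off\<close> is the dimension of the common intersection of all hyperplanes.
\<close>

locale root_family =
  fixes J :: "nat \<Rightarrow> int set" and off :: nat
  assumes J_range: "\<And>i j. i \<ge> 1 \<Longrightarrow> j \<in> J i \<Longrightarrow> \<bar>j\<bar> < int i"
    and J_low: "\<And>i. 1 \<le> i \<Longrightarrow> i \<le> off \<Longrightarrow> J i = {}"
    and J_base: "\<And>i. off < i \<Longrightarrow> int off \<in> J i"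
    and J_closed: "\<And>i j k. i \<ge> 1 \<Longrightarrow> j \<in> J i \<Longrightarrow> k \<in> J i \<Longrightarrow> j \<noteq> k \<Longrightarrow>
      \<exists>i'\<in>{1..<i}. \<exists>j'\<in>J i'. \<exists>s. s \<noteq> 0 \<and>
        (\<forall>c. signed_entry c j - signed_entry c k = s * root_eval (i', j') c)"
begin

definition roots :: "nat \<Rightarrow> (nat \<times> int) set" where
  "roots n = Sigma {1..n} J"

text \<open>The dimension of the smallest intersection of hyperplanes that contains \<open>c\<close>.\<close>

definition rank :: "nat \<Rightarrow> (nat \<Rightarrow> real) \<Rightarrow> nat" where
  "rank n c = card {i \<in> {1..n}. \<forall>j\<in>J i. root_eval (i, j) c \<noteq> 0}"

text \<open>
  For the equations of a regular configuration, any \<open>d\<close> partial sums are independent iff the kernel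
  has no vector of small nonzero rank; this form is stable under restriction and projection.
\<close>

definition generic :: "nat \<Rightarrow> nat set \<Rightarrow> (nat \<Rightarrow> nat \<Rightarrow> real) \<Rightarrow> bool" where
  "generic n K M \<longleftrightarrow> (\<forall>c \<in> kernel_space n K M. rank n c \<le> off \<or> rank n c > card K + off)"

text \<open>Here \<open>d\<close> is the number of equations. For \<open>d = 0\<close> truncated
  subtraction gives \<open>d - 1 = 0\<close>, so a new coordinate multiplies the value by
  \<open>card (J (Suc n)) + 1\<close>. For \<open>d > 0\<close> and \<open>Suc n = d + off\<close>,
  a kernel in general position lies in the union of the hyperplanes, hence the value 0.\<close>

primrec chamber_number :: "nat \<Rightarrow> nat \<Rightarrow> nat" where
  "chamber_number 0 d = (if d = 0 then 1 else 0)"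
| "chamber_number (Suc n) d = (if d > 0 \<and> Suc n \<le> d + off then 0
     else card (J (Suc n)) * chamber_number n d + chamber_number n (d - 1))"

lemma finite_J: "i \<ge> 1 \<Longrightarrow> finite (J i)"
  by (rule finite_subset[of _ "{- int i..int i}"]) (use J_range in fastforce)+

lemma finite_roots: "finite (roots n)"
  unfolding roots_def by (auto intro!: finite_SigmaI finite_J)

lemma roots_Suc: "roots (Suc n) = {Suc n} \<times> J (Suc n) \<union> roots n"
  by (auto simp: roots_def le_Suc_eq)

lemma root_eval_cong:
  assumes "i \<in> {1..n}" "j \<in> J i" "\<And>m. m \<in> {1..n} \<Longrightarrow> c m = c' m"
  shows "root_eval (i, j) c = root_eval (i, j) c'"
proof -
  have "signed_entry c j = signed_entry c' j"
  proof (cases "j = 0")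
    case False
    then have "nat \<bar>j\<bar> \<in> {1..n}" using J_range[of i j] assms by auto
    then show ?thesis using assms(3) by (intro signed_entry_cong) auto
  qed simp
  then show ?thesis using assms by (simp add: root_eval_def)
qed

lemma rank_cong: "(\<And>m. m \<in> {1..n} \<Longrightarrow> c m = c' m) \<Longrightarrow> rank n c = rank n c'"
  unfolding rank_def by (rule arg_cong[where f = card]) (use root_eval_cong[of _ n _ c c'] in fastforce)

lemma rank_le: "rank n c \<le> n"
proof -
  have "rank n c \<le> card {1..n}" unfolding rank_def by (intro card_mono) auto
  then show ?thesis by simp
qed

lemma rank_Suc:
  "rank (Suc n) c = rank n c + (if \<forall>j\<in>J (Suc n). root_eval (Suc n, j) c \<noteq> 0 then 1 else 0)"
proof -
  have "{i \<in> {1..Suc n}. \<forall>j\<in>J i. root_eval (i, j) c \<noteq> 0} =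
     {i \<in> {1..n}. \<forall>j\<in>J i. root_eval (i, j) c \<noteq> 0} \<union>
     (if \<forall>j\<in>J (Suc n). root_eval (Suc n, j) c \<noteq> 0 then {Suc n} else {})"
    by (auto simp: le_Suc_eq)
  then show ?thesis unfolding rank_def by (simp add: card_Un_disjoint)
qed

section \<open>Bounds for the rank\<close>

text \<open>At the first nonzero coordinate \<open>p\<close> every functional of index
  \<open>p\<close> takes the value \<open>c p\<close>. Together with the indices up to
  \<open>off\<close>, which have no hyperplanes and always count, this gives
  \<open>off + 1\<close>.\<close>

lemma rank_gt_off:
  assumes i: "i \<in> {off<..n}" "c i \<noteq> 0" and low: "\<And>m. m \<in> {1..off} \<Longrightarrow> c m = 0"
  shows "rank n c > off"
proof -
  obtain p where p: "p \<in> {1..n}" "c p \<noteq> 0" "\<And>m. m \<in> {1..<p} \<Longrightarrow> c m = 0"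
  proof -
    let ?P = "\<lambda>p. p \<in> {1..n} \<and> c p \<noteq> 0"
    have P: "?P (LEAST p. ?P p)" by (rule LeastI[of ?P i]) (use i in auto)
    moreover have "c m = 0" if "m \<in> {1..<LEAST p. ?P p}" for m
      using not_less_Least[of m ?P] that P by auto
    ultimately show thesis using that by blast
  qed
  have poff: "p > off" using p low by (metis atLeastAtMost_iff not_le)
  have "root_eval (p, j) c \<noteq> 0" if "j \<in> J p" for j
  proof -
    have "signed_entry c j = 0"
    proof (cases "j = 0")
      case False
      then have "nat \<bar>j\<bar> \<in> {1..<p}" using J_range[of p j] that p by auto
      then show ?thesis using p(3) by (simp add: signed_entry_def)
    qed simp
    then show ?thesis using p by (simp add: root_eval_def)
  qed
  then have "card (insert p {1..off}) \<le> rank n c"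
    unfolding rank_def using J_low poff p(1) by (intro card_mono) auto
  then show ?thesis using poff by simp
qed

text \<open>An index \<open>i > off\<close> outside \<open>S\<close> does not count, because
  \<open>c i\<close> and \<open>signed_entry c (int off)\<close> are both 0 and
  \<open>int off\<close> belongs to \<open>J i\<close>. For \<open>off = 0\<close> this is the
  hyperplane where \<open>c i\<close> vanishes.\<close>

lemma rank_le_support:
  assumes S: "finite S" "\<And>m. m \<in> {1..n} - S \<Longrightarrow> c m = 0"
    and low: "off > 0 \<Longrightarrow> c off = 0"
    and q: "q \<in> {1..n}" "j \<in> J q" "root_eval (q, j) c = 0"
  shows "rank n c \<le> off + card (S - {q})"
proof -
  have "{i \<in> {1..n}. \<forall>j\<in>J i. root_eval (i, j) c \<noteq> 0} \<subseteq> {1..off} \<union> (S - {q})"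
  proof
    fix i assume i: "i \<in> {i \<in> {1..n}. \<forall>j\<in>J i. root_eval (i, j) c \<noteq> 0}"
    have "i \<noteq> q" using i q by auto
    moreover have "i \<in> {1..off}" if "i \<notin> S"
    proof (rule ccontr)
      assume "i \<notin> {1..off}"
      then have "int off \<in> J i" using i J_base by auto
      moreover have "root_eval (i, int off) c = 0"
        using S(2)[of i] i that low by (cases "off = 0") (auto simp: root_eval_def)
      ultimately show False using i by auto
    qed
    ultimately show "i \<in> {1..off} \<union> (S - {q})" by blast
  qed
  then have "rank n c \<le> card ({1..off} \<union> (S - {q}))"
    unfolding rank_def using S(1) by (intro card_mono) auto
  also have "\<dots> \<le> off + card (S - {q})" using card_Un_le[of "{1..off}" "S - {q}"] by simp
  finally show ?thesis .
qed

text \<open>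
  A solution supported on \<open>card K + 1\<close> coordinates, the last one included, would have too small a
  rank if it lay on the hyperplane.
\<close>

lemma generic_root_nonzero:
  assumes gen: "generic (Suc n) K M" and K: "finite K" "Suc n > card K + off" and j: "j \<in> J (Suc n)"
  shows "\<exists>a\<in>kernel_space (Suc n) K M. root_eval (Suc n, j) a \<noteq> 0"
proof (rule ccontr)
  assume "\<not> ?thesis"
  then have zero: "root_eval (Suc n, j) a = 0" if "a \<in> kernel_space (Suc n) K M" for a
    using that by blast
  \<comment> \<open>These are \<open>card K + 1\<close> unknowns, one more than there are equations.
    The coordinates up to \<open>off\<close> are left out, so that \<open>c\<close> vanishes there
    as both rank bounds require.\<close>
  define S where "S = insert (Suc n) {Suc off..card K + off}"
  have S: "finite S" "S \<subseteq> {1..Suc n}" "card S = Suc (card K)" "card (S - {Suc n}) = card K"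
    using K by (auto simp: S_def)
  obtain c where c: "\<forall>i. i \<notin> S \<longrightarrow> c i = 0" "\<exists>i\<in>S. c i \<noteq> 0" "\<forall>k\<in>K. (\<Sum>i\<in>S. c i * M k i) = 0"
    using underdetermined_system[of K S M] K S by auto
  have "(\<Sum>i=1..Suc n. c i * M k i) = (\<Sum>i\<in>S. c i * M k i)" for k
    using c(1) S(2) by (intro sum.mono_neutral_right) auto
  then have ker: "c \<in> kernel_space (Suc n) K M" using c(3) unfolding kernel_space_def by simp
  have "rank (Suc n) c \<le> off + card (S - {Suc n})"
    using K by (rule_tac rank_le_support[of S "Suc n" c "Suc n" j])
      (use c(1) S j zero[OF ker] in \<open>auto simp: S_def\<close>)
  moreover have "rank (Suc n) c > off"
  proof -
    obtain i where "i \<in> S" "c i \<noteq> 0" using c(2) by blast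
    then show ?thesis using c(1) K by (intro rank_gt_off[of i]) (auto simp: S_def)
  qed
  ultimately show False using gen ker S(4) unfolding generic_def by force
qed

section \<open>Restriction and projection of generic kernels\<close>

text \<open>On the hyperplane the last coordinate equals \<open>signed_entry c j\<close>;
  substituting it adds the last column, with the sign of \<open>j\<close>, to column
  \<open>nat \<bar>j\<bar>\<close>. Index \<open>Suc n\<close> does not count towards the rank
  there, so neither the rank nor the number of equations changes.\<close>

lemma generic_restrict:
  assumes gen: "generic (Suc n) K M" and j: "j \<in> J (Suc n)"
  defines "M' \<equiv> \<lambda>k i. M k i + (if int i = \<bar>j\<bar> then of_int (sgn j) * M k (Suc n) else 0)"
  shows "generic n K M'"
    and "regions root_eval {c \<in> kernel_space (Suc n) K M. root_eval (Suc n, j) c = 0} (roots n) =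
         regions root_eval (kernel_space n K M') (roots n)"
proof -
  have jn: "nat \<bar>j\<bar> \<le> n" using J_range[of "Suc n" j] j by auto
  have sum': "(\<Sum>i=1..n. c i * M' k i) = (\<Sum>i=1..n. c i * M k i) + signed_entry c j * M k (Suc n)" for c k
  proof -
    have "(\<Sum>i=1..n. c i * (if int i = \<bar>j\<bar> then of_int (sgn j) * M k (Suc n) else 0)) =
      (\<Sum>i=1..n. if i = nat \<bar>j\<bar> then signed_entry c j * M k (Suc n) else 0)"
      by (intro sum.cong) (auto simp: signed_entry_def)
    also have "\<dots> = signed_entry c j * M k (Suc n)"
      using jn by (cases "j = 0") (auto simp: sum.delta)
    finally show ?thesis by (simp add: M'_def algebra_simps sum.distrib)
  qed
  have down: "c \<in> kernel_space n K M'"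
    if c: "c \<in> kernel_space (Suc n) K M" "root_eval (Suc n, j) c = 0" for c
  proof -
    have "(\<Sum>i=1..n. c i * M' k i) = 0" if "k \<in> K" for k
      unfolding sum' using that c by (auto simp: kernel_space_def root_eval_def)
    then show ?thesis by (simp add: kernel_space_def)
  qed
  let ?up = "\<lambda>c. c(Suc n := signed_entry c j)"
  have entry: "signed_entry (?up c) j = signed_entry c j" for c
    using jn by (intro signed_entry_cong) auto
  have up: "?up c \<in> kernel_space (Suc n) K M" "root_eval (Suc n, j) (?up c) = 0"
    if "c \<in> kernel_space n K M'" for c
  proof -
    have "(\<Sum>i=1..n. ?up c i * M k i) = (\<Sum>i=1..n. c i * M k i)" for k
      by (intro sum.cong) auto
    then show "?up c \<in> kernel_space (Suc n) K M"
      using that unfolding kernel_space_def sum' by simp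
    show "root_eval (Suc n, j) (?up c) = 0" using entry by (simp add: root_eval_def)
  qed
  show "generic n K M'"
    unfolding generic_def
  proof
    fix c assume c: "c \<in> kernel_space n K M'"
    have "rank n c = rank n (?up c)" by (rule rank_cong) auto
    also have "\<dots> = rank (Suc n) (?up c)" using up(2)[OF c] j by (auto simp: rank_Suc)
    finally show "rank n c \<le> off \<or> rank n c > card K + off"
      using gen up(1)[OF c] unfolding generic_def by auto
  qed
  show "regions root_eval {c \<in> kernel_space (Suc n) K M. root_eval (Suc n, j) c = 0} (roots n) =
         regions root_eval (kernel_space n K M') (roots n)"
  proof (rule regions_cong)
    fix b assume b: "b \<in> kernel_space n K M'"
    have "root_eval r (?up b) = root_eval r b" if "r \<in> roots n" for r
      using that root_eval_cong[of "fst r" n "snd r" "?up b" b] by (auto simp: roots_def)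
    then show "\<exists>a\<in>{c \<in> kernel_space (Suc n) K M. root_eval (Suc n, j) c = 0}.
        \<forall>r\<in>roots n. root_eval r a = root_eval r b"
      using up[OF b] by blast
  qed (use down in blast)
qed

text \<open>The last unit vector has rank \<open>off + 1\<close>, too small for a nontrivial kernel
  vector, so some equation involves the last coordinate and can serve as pivot. Forgetting that
  coordinate lowers the rank by at most one, which matches the loss of one equation.\<close>

lemma generic_project:
  assumes gen: "generic (Suc n) K M" and K: "finite K" "K \<noteq> {}" "Suc n > off"
  obtains K' M' where "finite K'" "card K' = card K - 1" "generic n K' M'"
    "regions root_eval (kernel_space (Suc n) K M) (roots n) =
     regions root_eval (kernel_space n K' M') (roots n)"
proof -
  obtain p where p: "p \<in> K" "M p (Suc n) \<noteq> 0"
  proof -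
    let ?e = "\<lambda>i. if i = Suc n then 1 else (0::real)"
    have "rank n ?e \<le> off"
    proof (cases "n = off")
      case True
      then show ?thesis using rank_le by metis
    next
      case False
      then have n: "off < n" using K by simp
      have "rank n ?e = rank n (\<lambda>_. 0)" by (rule rank_cong) auto
      also have "\<dots> \<le> off + card ({} - {n})"
        using n J_base[of n]
        by (intro rank_le_support[of "{}" _ _ n "int off"]) (auto simp: root_eval_def signed_entry_def)
      finally show ?thesis by simp
    qed
    then have "rank (Suc n) ?e \<le> Suc off" by (simp add: rank_Suc)
    moreover have "rank (Suc n) ?e > off" using K by (intro rank_gt_off[of "Suc n"]) auto
    moreover have "card K > 0" using K by auto
    ultimately have "?e \<notin> kernel_space (Suc n) K M"
      using gen unfolding generic_def by force
    then have "\<exists>k\<in>K. M k (Suc n) \<noteq> 0" by (auto simp: kernel_space_def)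
    with that show thesis by blast
  qed
  define M' where "M' k i = M k i - M k (Suc n) / M p (Suc n) * M p i" for k i
  note elim = kernel_space_eliminate_last[of p K M n M', OF p M'_def]
  let ?up = "\<lambda>b. b(Suc n := - (\<Sum>i=1..n. b i * M p i) / M p (Suc n))"
  have "generic n (K - {p}) M'"
    unfolding generic_def
  proof
    fix c assume c: "c \<in> kernel_space n (K - {p}) M'"
    have "rank n c = rank n (?up c)" by (rule rank_cong) auto
    then have "rank (Suc n) (?up c) \<le> rank n c + 1" "rank n c \<le> rank (Suc n) (?up c)"
      by (simp_all add: rank_Suc)
    moreover have "rank (Suc n) (?up c) \<le> off \<or> rank (Suc n) (?up c) > card K + off"
      using gen elim(2)[OF c] unfolding generic_def by blast
    moreover have "card K > 0" using K by auto
    ultimately show "rank n c \<le> off \<or> rank n c > card (K - {p}) + off"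
      using p K by auto
  qed
  moreover have "regions root_eval (kernel_space (Suc n) K M) (roots n) =
     regions root_eval (kernel_space n (K - {p}) M') (roots n)"
  proof (rule regions_cong)
    fix b assume b: "b \<in> kernel_space n (K - {p}) M'"
    have "root_eval r (?up b) = root_eval r b" if "r \<in> roots n" for r
      using that root_eval_cong[of "fst r" n "snd r" "?up b" b] by (auto simp: roots_def)
    then show "\<exists>a\<in>kernel_space (Suc n) K M. \<forall>r\<in>roots n. root_eval r a = root_eval r b"
      using elim(2)[OF b] by blast
  qed (use elim(1) in blast)
  ultimately show thesis using that[of "K - {p}" M'] K p by simp
qed

text \<open>The third hypothesis is the range in which the zero branch of
  \<open>chamber_number\<close> is the true count. Outside that branch, restriction and projection
  both lead back into the range.\<close>

theorem card_regions_generic: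
  assumes "finite K" "generic n K M" "card K = 0 \<or> card K + off \<le> n"
  shows "card (regions root_eval (kernel_space n K M) (roots n)) = chamber_number n (card K)"
  using assms
proof (induction n arbitrary: K M)
  case 0
  then have "K = {}" by auto
  then show ?case by (auto simp: regions_def roots_def kernel_space_def)
next
  case (Suc n)
  show ?case
  proof (cases "card K > 0 \<and> Suc n \<le> card K + off")
    case True
    \<comment> \<open>Here \<open>Suc n = card K + off\<close>. A point of a region would have rank
      \<open>Suc n\<close>, which genericity excludes.\<close>
    have "regions root_eval (kernel_space (Suc n) K M) (roots (Suc n)) = {}"
    proof (rule ccontr)
      assume "\<not> ?thesis"
      then obtain c where c: "c \<in> kernel_space (Suc n) K M" "\<forall>r\<in>roots (Suc n). root_eval r c \<noteq> 0"
        by (auto elim!: regionsE)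
      have "rank (Suc n) c = card {1..Suc n}"
        unfolding rank_def using c(2) by (intro arg_cong[where f = card]) (auto simp: roots_def)
      then have "rank (Suc n) c = Suc n" by simp
      then show False using Suc.prems True c(1) unfolding generic_def by force
    qed
    then show ?thesis using True by simp
  next
    case False
    let ?L = "kernel_space (Suc n) K M"
    have nonzero: "\<exists>a\<in>?L. root_eval g a \<noteq> 0" if "g \<in> {Suc n} \<times> J (Suc n)" for g
    proof -
      obtain j where j: "g = (Suc n, j)" "j \<in> J (Suc n)" using \<open>g \<in> _\<close> by auto
      then have "\<not> Suc n \<le> off" using J_low by fastforce
      then show ?thesis using generic_root_nonzero[OF Suc.prems(2,1) _ j(2)] False j(1) by auto
    qed
    \<comment> \<open>Wherever \<open>g\<close> vanishes, the value of \<open>h\<close> is the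
      difference of signed entries treated in \<open>J_closed\<close>.\<close>
    have proportional: "\<exists>r\<in>roots n. \<exists>s. s \<noteq> 0 \<and>
        (\<forall>c\<in>?L. root_eval g c = 0 \<longrightarrow> root_eval h c = s * root_eval r c)"
      if gh: "g \<in> {Suc n} \<times> J (Suc n)" "h \<in> {Suc n} \<times> J (Suc n)" "g \<noteq> h" for g h
    proof -
      obtain j k where j: "g = (Suc n, j)" "j \<in> J (Suc n)" and k: "h = (Suc n, k)" "k \<in> J (Suc n)"
        using gh by auto
      obtain i' j' s where "i' \<in> {1..<Suc n}" "j' \<in> J i'" "s \<noteq> 0"
        "\<forall>c. signed_entry c j - signed_entry c k = s * root_eval (i', j') c"
        using J_closed[of "Suc n" j k] j k gh(3) by auto
      then show ?thesis unfolding j k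
        by (intro bexI[of _ "(i', j')"] exI[of _ s]) (auto simp: root_eval_def roots_def)
    qed
    have "card (regions root_eval ?L (roots (Suc n))) = card (regions root_eval ?L (roots n)) +
        (\<Sum>g\<in>{Suc n} \<times> J (Suc n). card (regions root_eval {c \<in> ?L. root_eval g c = 0} (roots n)))"
      unfolding roots_Suc
      by (rule card_regions_union)
         (use nonzero proportional finite_roots finite_J in
           \<open>auto simp: roots_def combination_closed_kernel_space\<close>)
    also have "(\<Sum>g\<in>{Suc n} \<times> J (Suc n). card (regions root_eval {c \<in> ?L. root_eval g c = 0} (roots n))) =
        (\<Sum>g\<in>{Suc n} \<times> J (Suc n). chamber_number n (card K))"
    proof (rule sum.cong[OF refl])
      fix g assume "g \<in> {Suc n} \<times> J (Suc n)"
      then obtain j where j: "g = (Suc n, j)" "j \<in> J (Suc n)" by auto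
      note res = generic_restrict[OF Suc.prems(2) j(2)]
      show "card (regions root_eval {c \<in> ?L. root_eval g c = 0} (roots n)) = chamber_number n (card K)"
        unfolding j(1) res(2) by (rule Suc.IH[OF Suc.prems(1) res(1)]) (use False in auto)
    qed
    also have "card (regions root_eval ?L (roots n)) = chamber_number n (card K - 1)"
    \<comment> \<open>Without equations the kernel is the whole space for every \<open>n\<close>, so
      nothing is eliminated, in line with \<open>0 - 1 = 0\<close>.\<close>
    proof (cases "K = {}")
      case True
      have "generic n {} M" using Suc.prems(2) True unfolding generic_def by auto
      then show ?thesis using Suc.IH[of "{}" M] True by (auto simp: kernel_space_def)
    next
      case K: False
      then have "Suc n > off" using False Suc.prems(1) by (auto simp: card_gt_0_iff)
      then obtain K' M' where "finite K'" "card K' = card K - 1" "generic n K' M'"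
        "regions root_eval ?L (roots n) = regions root_eval (kernel_space n K' M') (roots n)"
        using generic_project[OF Suc.prems(2,1) K] by blast
      moreover have "card K - 1 = 0 \<or> card K - 1 + off \<le> n" using False by linarith
      ultimately show ?thesis using Suc.IH[of K' M'] by simp
    qed
    moreover have "chamber_number (Suc n) (card K) =
        card (J (Suc n)) * chamber_number n (card K) + chamber_number n (card K - 1)"
      using if_not_P[OF False] by (simp only: chamber_number.simps)
    ultimately show ?thesis by (simp add: card_cartesian_product_singleton)
  qed
qed

end

subsection \<open>Configurations in general position\<close>

lemma lookup_scaleR_poly_mapping [simp]:
  "Poly_Mapping.lookup (s *\<^sub>R (x :: 'a \<Rightarrow>\<^sub>0 real)) k = s * Poly_Mapping.lookup x k"
proof -
  have "finite {i. s * Poly_Mapping.lookup x i \<noteq> 0}"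
    by (rule finite_subset[of _ "Poly_Mapping.keys x"]) (auto simp: in_keys_iff)
  then show ?thesis by (simp add: scaleR_poly_mapping_def)
qed

lemma Rspace_eq: "Rspace d = {v. \<forall>k. k \<notin> {1..d} \<longrightarrow> Poly_Mapping.lookup v k = 0}"
  by (auto simp: Rspace_def in_keys_iff)

lemma subspace_Rspace: "subspace (Rspace d)"
  by (auto simp: subspace_def Rspace_eq lookup_add)

lemma combination_eq_zero_iff:
  assumes "\<And>i. i \<in> S \<Longrightarrow> v i \<in> Rspace d"
  shows "(\<Sum>i\<in>S. c i *\<^sub>R v i) = 0 \<longleftrightarrow>
    (\<forall>k\<in>{1..d}. (\<Sum>i\<in>S. c i * Poly_Mapping.lookup (v i) k) = 0)"
proof -
  have "(\<Sum>i\<in>S. c i * Poly_Mapping.lookup (v i) k) = 0" if "k \<notin> {1..d}" for k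
    using assms that by (intro sum.neutral) (auto simp: Rspace_eq)
  then show ?thesis by (auto simp: poly_mapping_eq_iff fun_eq_iff lookup_sum)
qed

section \<open>Independent families and positive relations\<close>

text \<open>\<open>any_independent\<close> speaks of exactly \<open>d\<close> indices; a smaller set
  is filled up, with coefficient 0 at the new indices, for which \<open>d \<le> m\<close> leaves
  room.\<close>

lemma any_independentD:
  assumes v: "any_independent d m v" "d \<le> m" and S: "S \<subseteq> {1..m}" "card S \<le> d"
    and sum: "(\<Sum>k\<in>S. u k *\<^sub>R v k) = 0" and k: "k \<in> S"
  shows "u k = 0"
proof -
  obtain I where I: "S \<subseteq> I" "I \<subseteq> {1..m}" "card I = d"
    using exists_subset_between[of S d "{1..m}"] S v by auto
  have finI: "finite I" using I finite_subset by auto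
  have inj: "inj_on v I" and ind: "independent (v ` I)"
    using v I unfolding any_independent_def by auto
  define u' where "u' i = (if i \<in> S then u i else 0)" for i
  have "(\<Sum>w\<in>v ` I. u' (inv_into I v w) *\<^sub>R w) = (\<Sum>i\<in>I. u' i *\<^sub>R v i)"
    using inj by (simp add: sum.reindex)
  also have "\<dots> = (\<Sum>i\<in>S. u i *\<^sub>R v i)"
    using I finI by (intro sum.mono_neutral_cong_right) (auto simp: u'_def)
  finally have "u' (inv_into I v (v k)) = 0"
    using independentD[OF ind, of "v ` I" "\<lambda>w. u' (inv_into I v w)" "v k"] finI sum I k by auto
  then show ?thesis using inj I k by (auto simp: u'_def subset_iff)
qed

lemma independent_family_iff:
  fixes v :: "'i \<Rightarrow> 'v::real_vector"
  assumes "finite S"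
  shows "inj_on v S \<and> independent (v ` S) \<longleftrightarrow>
    (\<forall>u. (\<Sum>k\<in>S. u k *\<^sub>R v k) = 0 \<longrightarrow> (\<forall>k\<in>S. u k = 0))" (is "?L \<longleftrightarrow> ?R")
proof
  assume L: ?L
  show ?R
  proof (intro allI impI ballI)
    fix u k assume sum: "(\<Sum>k\<in>S. u k *\<^sub>R v k) = 0" and k: "k \<in> S"
    have "(\<Sum>w\<in>v ` S. u (inv_into S v w) *\<^sub>R w) = 0"
      using L sum by (simp add: sum.reindex)
    then have "u (inv_into S v (v k)) = 0"
      using independentD[of "v ` S" "v ` S" "\<lambda>w. u (inv_into S v w)" "v k"] L assms k by auto
    then show "u k = 0" using L k by simp
  qed
next
  assume R: ?R
  have inj: "inj_on v S"
  proof (rule inj_onI)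
    fix a b assume ab: "a \<in> S" "b \<in> S" "v a = v b"
    show "a = b"
    proof (rule ccontr)
      assume ne: "a \<noteq> b"
      let ?u = "\<lambda>k. if k = a then 1 else if k = b then -1 else (0::real)"
      have "(\<Sum>k\<in>S. ?u k *\<^sub>R v k) = (\<Sum>k\<in>{a, b}. ?u k *\<^sub>R v k)"
        using assms ab by (intro sum.mono_neutral_right) auto
      also have "\<dots> = 0" using ab ne by simp
      finally show False using R[rule_format, of ?u a] ab by simp
    qed
  qed
  moreover have "independent (v ` S)"
  proof
    assume "dependent (v ` S)"
    then obtain u where u: "\<exists>w\<in>v ` S. u w \<noteq> 0" "(\<Sum>w\<in>v ` S. u w *\<^sub>R w) = 0"
      using dependent_finite[of "v ` S"] assms by auto
    then have "(\<Sum>k\<in>S. u (v k) *\<^sub>R v k) = 0" using inj by (simp add: sum.reindex)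
    then show False using R[rule_format, of "\<lambda>k. u (v k)"] u(1) by auto
  qed
  ultimately show ?L by simp
qed

lemma any_independentI:
  assumes "\<And>u k. (\<Sum>k=1..m. u k *\<^sub>R v k) = 0 \<Longrightarrow> k \<in> {1..m} \<Longrightarrow> u k = 0"
  shows "any_independent d m v"
proof -
  have "inj_on v {1..m} \<and> independent (v ` {1..m})"
    using assms by (subst independent_family_iff) auto
  then show ?thesis unfolding any_independent_def
    by (meson image_mono independent_mono inj_on_subset)
qed

lemma zero_in_convex_hull_image_iff:
  fixes v :: "'i \<Rightarrow> 'v::real_vector"
  assumes "finite S"
  shows "0 \<in> convex hull (v ` S) \<longleftrightarrow>
    (\<exists>u. (\<forall>k\<in>S. 0 \<le> u k) \<and> sum u S = 1 \<and> (\<Sum>k\<in>S. u k *\<^sub>R v k) = 0)" (is "?L \<longleftrightarrow> ?R")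
proof
  assume ?L
  then obtain w where w: "\<forall>x\<in>v ` S. 0 \<le> w x" "sum w (v ` S) = 1" "(\<Sum>x\<in>v ` S. w x *\<^sub>R x) = 0"
    using convex_hull_finite[of "v ` S"] assms by auto
  \<comment> \<open>The hull depends on the set of values only, and \<open>v\<close> may repeat
    them; \<open>T\<close> keeps one index per value, which receives the whole weight.\<close>
  obtain T where T: "T \<subseteq> S" "inj_on v T" "v ` S = v ` T"
    by (meson subset_image_inj order_refl)
  let ?u = "\<lambda>k. if k \<in> T then w (v k) else 0"
  have "sum ?u S = sum w (v ` T)"
    using T(1,2) assms by (simp add: sum.reindex sum.inter_restrict[symmetric] Int_absorb1 if_distrib)
  moreover have "(\<Sum>k\<in>S. ?u k *\<^sub>R v k) = (\<Sum>k\<in>T. w (v k) *\<^sub>R v k)"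
    using T(1) assms by (intro sum.mono_neutral_cong_right) auto
  moreover have "\<dots> = (\<Sum>x\<in>v ` T. w x *\<^sub>R x)" using T(2) by (simp add: sum.reindex)
  ultimately show ?R using w T by (intro exI[of _ ?u]) auto
next
  assume ?R
  then obtain u where u: "\<forall>k\<in>S. 0 \<le> u k" "sum u S = 1" "(\<Sum>k\<in>S. u k *\<^sub>R v k) = 0" by blast
  have "(\<Sum>k\<in>S. u k *\<^sub>R v k) \<in> convex hull (v ` S)"
    using u assms by (intro convex_sum) (auto simp: hull_inc)
  then show ?L using u by simp
qed

text \<open>
  A relation with inclusion-maximal support involves all vectors: its support contains \<open>d\<close>
  vectors, which span the space, so any further vector could be added with a small coefficient.
\<close>

lemma hull_contains_zero_iff_positive:
  assumes v: "any_independent d m v" "d \<le> m" "1 \<le> m" and R: "v ` {1..m} \<subseteq> Rspace d"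
  shows "hull_contains_zero m v \<longleftrightarrow>
    (\<exists>u. (\<forall>k\<in>{1..m}. 0 < u k) \<and> (\<Sum>k=1..m. u k *\<^sub>R v k) = 0)" (is "?L \<longleftrightarrow> ?R")
proof
  assume ?R
  then obtain u where u: "\<forall>k\<in>{1..m}. 0 < u k" "(\<Sum>k=1..m. u k *\<^sub>R v k) = 0" by blast
  have pos: "sum u {1..m} > 0" using u(1) v(3) by (intro sum_pos) auto
  let ?w = "\<lambda>k. u k / sum u {1..m}"
  have "(\<Sum>k=1..m. ?w k *\<^sub>R v k) = (1 / sum u {1..m}) *\<^sub>R (\<Sum>k=1..m. u k *\<^sub>R v k)"
    by (simp add: scaleR_sum_right)
  then have "(\<Sum>k=1..m. ?w k *\<^sub>R v k) = 0" using u(2) by simp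
  moreover have "sum ?w {1..m} = 1" using pos by (simp add: sum_divide_distrib[symmetric])
  ultimately show ?L unfolding hull_contains_zero_def
    using u(1) pos zero_in_convex_hull_image_iff[of "{1..m}" v]
    by (auto intro!: exI[of _ ?w] simp: less_imp_le)
next
  assume ?L
  then obtain u0 where u0: "\<forall>k\<in>{1..m}. 0 \<le> u0 k" "sum u0 {1..m} = 1" "(\<Sum>k=1..m. u0 k *\<^sub>R v k) = 0"
    unfolding hull_contains_zero_def using zero_in_convex_hull_image_iff[of "{1..m}" v] by auto
  define F where "F = {K. K \<subseteq> {1..m} \<and> K \<noteq> {} \<and>
    (\<exists>u. (\<forall>k\<in>K. 0 < u k) \<and> (\<Sum>k\<in>K. u k *\<^sub>R v k) = 0)}"
  have "finite F" unfolding F_def by simp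
  moreover have "{k \<in> {1..m}. u0 k \<noteq> 0} \<in> F"
  proof -
    have "(\<Sum>k\<in>{k \<in> {1..m}. u0 k \<noteq> 0}. u0 k *\<^sub>R v k) = (\<Sum>k=1..m. u0 k *\<^sub>R v k)"
      by (intro sum.mono_neutral_left) auto
    moreover have "{k \<in> {1..m}. u0 k \<noteq> 0} \<noteq> {}"
    proof
      assume "{k \<in> {1..m}. u0 k \<noteq> 0} = {}"
      then have "sum u0 {1..m} = 0" by (intro sum.neutral) auto
      then show False using u0 by simp
    qed
    ultimately show ?thesis using u0 unfolding F_def by (auto intro!: exI[of _ u0] simp: less_le)
  qed
  ultimately obtain K where K: "K \<in> F" "\<And>K'. K' \<in> F \<Longrightarrow> K \<subseteq> K' \<Longrightarrow> K = K'"
    using finite_has_maximal[of F] by blast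
  then obtain u where u: "K \<subseteq> {1..m}" "K \<noteq> {}" "\<forall>k\<in>K. 0 < u k" "(\<Sum>k\<in>K. u k *\<^sub>R v k) = 0"
    unfolding F_def by blast
  have finK: "finite K" using u finite_subset by auto
  have "K = {1..m}"
  proof (rule ccontr)
    assume "K \<noteq> {1..m}"
    then obtain p where p: "p \<in> {1..m}" "p \<notin> K" using u by blast
    \<comment> \<open>A positive relation among at most \<open>d\<close> vectors would contradict
      independence.\<close>
    have "card K > d"
    proof (rule ccontr)
      assume "\<not> card K > d"
      moreover obtain k where "k \<in> K" using u by blast
      ultimately have "u k = 0" using any_independentD[OF v(1,2) u(1) _ u(4)] by simp
      then show False using u \<open>k \<in> K\<close> by force
    qed
    then obtain T where T: "T \<subseteq> K" "card T = d" "finite T"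
      by (meson less_imp_le obtain_subset_with_card_n)
    have "p \<notin> T" using T p by blast
    then have card: "card (insert p T) = Suc d" using T by simp
    obtain c where c: "\<forall>i. i \<notin> insert p T \<longrightarrow> c i = 0" "\<exists>i\<in>insert p T. c i \<noteq> 0"
      "\<forall>k\<in>{1..d}. (\<Sum>i\<in>insert p T. c i * Poly_Mapping.lookup (v i) k) = 0"
      using underdetermined_system[of "{1..d}" "insert p T" "\<lambda>k i. Poly_Mapping.lookup (v i) k"] T card
      by auto
    have sum: "(\<Sum>i\<in>insert p T. c i *\<^sub>R v i) = 0"
    proof (subst combination_eq_zero_iff[of _ _ d])
      show "v i \<in> Rspace d" if "i \<in> insert p T" for i
        using that R T(1) p(1) u(1) by (intro subsetD[OF R] imageI) auto
    qed (rule c(3))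
    have cp: "c p \<noteq> 0"
    proof
      assume 0: "c p = 0"
      then have "(\<Sum>i\<in>T. c i *\<^sub>R v i) = 0" using sum T(3) \<open>p \<notin> T\<close> by simp
      then have "c i = 0" if "i \<in> T" for i
        using any_independentD[OF v(1,2), of T c i] T u that by auto
      then show False using c(2) 0 by auto
    qed
    have "\<forall>k\<in>K. u k \<noteq> 0" using u(3) by force
    then obtain \<delta> where \<delta>: "\<delta> > 0" "\<forall>k\<in>K. \<bar>\<delta> * (c k / c p)\<bar> < \<bar>u k\<bar>"
      using small_perturbation[OF finK, of u "\<lambda>k. c k / c p"] by blast
    \<comment> \<open>This is \<open>u\<close> plus \<open>\<delta> / c p\<close> times the relation
      \<open>c\<close>: the new vector gets weight \<open>\<delta>\<close>, and the choice of
      \<open>\<delta>\<close> keeps the weights on \<open>K\<close> positive.\<close>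
    define w where "w k = (if k = p then \<delta> else u k + \<delta> * (c k / c p))" for k
    have "\<forall>k\<in>insert p K. w k > 0"
    proof
      fix k assume "k \<in> insert p K"
      then consider "k = p" | "k \<in> K" "k \<noteq> p" by blast
      then show "w k > 0"
      proof cases
        case 2
        then have "\<bar>\<delta> * (c k / c p)\<bar> < \<bar>u k\<bar>" "0 < u k" using \<delta>(2) u(3) by blast+
        moreover have "w k = u k + \<delta> * (c k / c p)" using 2 by (simp add: w_def)
        ultimately show ?thesis by linarith
      qed (simp add: w_def \<delta>(1))
    qed
    moreover have "(\<Sum>k\<in>insert p K. w k *\<^sub>R v k) = 0"
    proof -
      have "(\<Sum>k\<in>insert p K. w k *\<^sub>R v k) =
          \<delta> *\<^sub>R v p + (\<Sum>k\<in>K. u k *\<^sub>R v k + (\<delta> / c p) *\<^sub>R (c k *\<^sub>R v k))"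
        using finK p by (auto simp: w_def algebra_simps intro!: sum.cong)
      also have "\<dots> = \<delta> *\<^sub>R v p + (\<delta> / c p) *\<^sub>R (\<Sum>k\<in>K. c k *\<^sub>R v k)"
        by (simp add: sum.distrib u(4) scaleR_sum_right)
      also have "\<dots> = (\<delta> / c p) *\<^sub>R (\<Sum>k\<in>insert p K. c k *\<^sub>R v k)"
        using finK p cp by (simp add: algebra_simps)
      also have "(\<Sum>k\<in>insert p K. c k *\<^sub>R v k) = (\<Sum>k\<in>insert p T. c k *\<^sub>R v k)"
        using c(1) T finK by (intro sum.mono_neutral_right) auto
      finally show ?thesis using sum by simp
    qed
    ultimately have "insert p K \<in> F" using u p unfolding F_def by blast
    then show False using K(2)[of "insert p K"] p by blast
  qed
  then show ?R using u by blast
qed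

text \<open>
  The functionals are evaluations of the polynomial with coefficient vector \<open>w\<close>. Each of them can be
  chosen to be nonzero on every nonzero subspace of the family, which lowers all dimensions by one.
\<close>

lemma generic_functionals:
  fixes Ws :: "rvec set set"
  assumes "finite Ws"
    and "\<And>W. W \<in> Ws \<Longrightarrow> subspace W"
    and "\<And>W w. W \<in> Ws \<Longrightarrow> w \<in> W \<Longrightarrow> Poly_Mapping.keys w \<subseteq> {..n}"
    and "\<And>W B. W \<in> Ws \<Longrightarrow> B \<subseteq> W \<Longrightarrow> independent B \<Longrightarrow> finite B \<and> card B \<le> d"
  shows "\<exists>t :: nat \<Rightarrow> real. \<forall>W\<in>Ws. \<forall>w\<in>W.
    (\<forall>k\<in>{1..d}. (\<Sum>i\<le>n. Poly_Mapping.lookup w i * t k ^ i) = 0) \<longrightarrow> w = 0"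
  using assms
proof (induction d arbitrary: Ws)
  case 0
  have "w = 0" if "W \<in> Ws" "w \<in> W" for W w
  proof (rule ccontr)
    assume "w \<noteq> 0"
    then have "independent {w}" by simp
    then show False using "0.prems"(4)[of W "{w}"] that by simp
  qed
  then show ?case by blast
next
  case (Suc d)
  define \<phi> where "\<phi> t w = (\<Sum>i\<le>n. Poly_Mapping.lookup w i * t ^ i)" for t :: real and w :: rvec
  have \<phi>_lin: "\<phi> t 0 = 0" "\<phi> t (v + w) = \<phi> t v + \<phi> t w" "\<phi> t (s *\<^sub>R w) = s * \<phi> t w" for t s v w
    by (simp_all add: \<phi>_def lookup_add algebra_simps sum.distrib sum_distrib_left)
  \<comment> \<open>One nonzero vector per subspace suffices: a functional not vanishing at it cuts
    the subspace down properly. Each such vector rules out only the finitely many roots of a nonzero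
    polynomial.\<close>
  define pick where "pick W = (SOME w. w \<in> W \<and> w \<noteq> 0)" for W :: "rvec set"
  have pick: "pick W \<in> W \<and> pick W \<noteq> 0" if "W \<noteq> {0}" "W \<in> Ws" for W
  proof -
    have "\<exists>w. w \<in> W \<and> w \<noteq> 0" using that Suc.prems(2)[of W] subspace_0 by blast
    then show ?thesis unfolding pick_def by (rule someI_ex)
  qed
  have fin: "finite {t. \<phi> t (pick W) = 0}" if W: "W \<in> Ws" "W \<noteq> {0}" for W
  proof -
    have "Poly_Mapping.keys (pick W) \<subseteq> {..n}" "Poly_Mapping.keys (pick W) \<noteq> {}"
      using Suc.prems(3)[of W "pick W"] pick W by auto
    then obtain i where "i \<le> n" "Poly_Mapping.lookup (pick W) i \<noteq> 0"
      by (metis atMost_iff in_keys_iff subset_eq ex_in_conv)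
    then show ?thesis unfolding \<phi>_def by (subst polyfun_finite_roots) auto
  qed
  have "finite (\<Union>W\<in>Ws - {{0}}. {t. \<phi> t (pick W) = 0})" using Suc.prems(1) fin by auto
  then obtain t0 where t0: "t0 \<notin> (\<Union>W\<in>Ws - {{0}}. {t. \<phi> t (pick W) = 0})"
    using ex_new_if_finite infinite_UNIV_char_0 by blast
  define Ws' where "Ws' = (\<lambda>W. {w \<in> W. \<phi> t0 w = 0}) ` Ws"
  have "\<exists>t :: nat \<Rightarrow> real. \<forall>W\<in>Ws'. \<forall>w\<in>W.
    (\<forall>k\<in>{1..d}. (\<Sum>i\<le>n. Poly_Mapping.lookup w i * t k ^ i) = 0) \<longrightarrow> w = 0"
  proof (rule Suc.IH)
    show "finite Ws'" using Suc.prems by (simp add: Ws'_def)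
    show "subspace W" if "W \<in> Ws'" for W
      using that Suc.prems(2) by (auto simp: Ws'_def subspace_def \<phi>_lin)
    show "Poly_Mapping.keys w \<subseteq> {..n}" if "W \<in> Ws'" "w \<in> W" for W w
      using that Suc.prems(3) unfolding Ws'_def by blast
    show "finite B \<and> card B \<le> d" if B: "W \<in> Ws'" "B \<subseteq> W" "independent B" for W B
    proof -
      obtain W0 where W0: "W0 \<in> Ws" "W = {w \<in> W0. \<phi> t0 w = 0}" using B by (auto simp: Ws'_def)
      show ?thesis
      proof (cases "W0 = {0}")
        case True
        then have "B \<subseteq> {0}" using B W0 by auto
        then have "B = {}" using B(3) dependent_zero by blast
        then show ?thesis by simp
      next
        case False
        note w = pick[OF False W0(1)]
        have "subspace W" using W0 Suc.prems(2) by (auto simp: subspace_def \<phi>_lin)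
        then have "span B \<subseteq> W" using B by (simp add: span_minimal)
        moreover have "\<phi> t0 (pick W0) \<noteq> 0" using t0 False W0 by auto
        ultimately have w': "pick W0 \<notin> span B" using W0 by auto
        \<comment> \<open>The dimension drops here: \<open>pick W0\<close> is not annihilated by the
          functional, so it extends every independent set of annihilated vectors.\<close>
        then have "independent (insert (pick W0) B)" using B(3) independent_insertI by blast
        then have "finite (insert (pick W0) B) \<and> card (insert (pick W0) B) \<le> Suc d"
          using Suc.prems(4)[OF W0(1), of "insert (pick W0) B"] B W0 w by auto
        moreover have "pick W0 \<notin> B" using w' span_base by blast
        ultimately show ?thesis by (metis Suc_le_mono card_insert_disjoint finite_insert)
      qed
    qed
  qed
  then obtain t where t: "\<And>W w. W \<in> Ws' \<Longrightarrow> w \<in> W \<Longrightarrow> \<forall>k\<in>{1..d}. \<phi> (t k) w = 0 \<Longrightarrow> w = 0"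
    unfolding \<phi>_def by blast
  have "w = 0" if W: "W \<in> Ws" "w \<in> W" and z: "\<forall>k\<in>{1..Suc d}. \<phi> ((t(Suc d := t0)) k) w = 0" for W w
  proof (rule t)
    show "{w \<in> W. \<phi> t0 w = 0} \<in> Ws'" using W by (auto simp: Ws'_def)
    show "w \<in> {w \<in> W. \<phi> t0 w = 0}" using W z by force
    show "\<forall>k\<in>{1..d}. \<phi> (t k) w = 0"
    proof
      fix k assume "k \<in> {1..d}"
      then show "\<phi> (t k) w = 0" using z[rule_format, of k] by simp
    qed
  qed
  then show ?case unfolding \<phi>_def by blast
qed

text \<open>Injectivity on the span of any \<open>d\<close> vectors of a family preserves their
  independence. Only finitely many spans arise, each of dimension at most \<open>d\<close>, so
  \<open>d\<close> generic functionals work for all families simultaneously.\<close>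

lemma generic_linear_map:
  fixes Vs :: "(nat \<Rightarrow> rvec) set"
  assumes fin: "finite Vs" and ind: "\<And>v. v \<in> Vs \<Longrightarrow> any_independent d m v"
    and keys: "\<And>v. v \<in> Vs \<Longrightarrow> v ` {1..m} \<subseteq> Rspace n"
  shows "\<exists>X. linear X \<and> range X \<subseteq> Rspace d \<and> (\<forall>v\<in>Vs. any_independent d m (X \<circ> v))"
proof -
  define Ws where "Ws = (\<lambda>(v, I). span (v ` I)) ` (Vs \<times> {I. I \<subseteq> {1..m} \<and> card I = d})"
  have "\<exists>t :: nat \<Rightarrow> real. \<forall>W\<in>Ws. \<forall>w\<in>W.
    (\<forall>k\<in>{1..d}. (\<Sum>i\<le>n. Poly_Mapping.lookup w i * t k ^ i) = 0) \<longrightarrow> w = 0"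
  proof (rule generic_functionals)
    show "finite Ws" using fin by (simp add: Ws_def)
    show "subspace W" if "W \<in> Ws" for W using that by (auto simp: Ws_def)
    show "Poly_Mapping.keys w \<subseteq> {..n}" if W: "W \<in> Ws" "w \<in> W" for W w
    proof -
      obtain v I where vI: "v \<in> Vs" "I \<subseteq> {1..m}" "w \<in> span (v ` I)" using W by (auto simp: Ws_def)
      have "span (v ` I) \<subseteq> Rspace n"
        using vI keys[of v] subspace_Rspace by (intro span_minimal) auto
      then show ?thesis using vI unfolding Rspace_def by fastforce
    qed
    show "finite B \<and> card B \<le> d" if W: "W \<in> Ws" "B \<subseteq> W" "independent B" for W B
    proof -
      obtain v I where vI: "v \<in> Vs" "I \<subseteq> {1..m}" "card I = d" "B \<subseteq> span (v ` I)"
        using W by (auto simp: Ws_def)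
      have finI: "finite I" using vI finite_subset by auto
      have "finite B \<and> card B \<le> card (v ` I)"
        using independent_span_bound[of "v ` I" B] finI W vI by simp
      then show ?thesis using card_image_le[OF finI, of v] vI by simp
    qed
  qed
  then obtain t :: "nat \<Rightarrow> real" where t: "\<And>W w. W \<in> Ws \<Longrightarrow> w \<in> W \<Longrightarrow>
    \<forall>k\<in>{1..d}. (\<Sum>i\<le>n. Poly_Mapping.lookup w i * t k ^ i) = 0 \<Longrightarrow> w = 0"
    by blast
  define \<phi> where "\<phi> k w = (\<Sum>i\<le>n. Poly_Mapping.lookup w i * t k ^ i)" for k :: nat and w :: rvec
  define X :: "rvec \<Rightarrow> rvec" where "X w = (\<Sum>k=1..d. Poly_Mapping.single k (\<phi> k w))" for w
  have lookX: "Poly_Mapping.lookup (X w) k = (if k \<in> {1..d} then \<phi> k w else 0)" for w k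
    by (simp add: X_def lookup_sum lookup_single when_def)
  have lin: "linear X"
    by (rule linearI; rule poly_mapping_eqI)
       (simp_all add: lookX lookup_add \<phi>_def algebra_simps sum.distrib sum_distrib_left)
  have "any_independent d m (X \<circ> v)" if v: "v \<in> Vs" for v
    unfolding any_independent_def
  proof (intro allI impI)
    fix I assume I: "I \<subseteq> {1..m}" "card I = d"
    have vI: "inj_on v I" "independent (v ` I)" using ind[OF v] I unfolding any_independent_def by auto
    have "w = 0" if "w \<in> span (v ` I)" "X w = 0" for w
    proof -
      have "\<forall>k\<in>{1..d}. \<phi> k w = 0" using that(2) lookX by (metis lookup_zero)
      then show ?thesis using t[of "span (v ` I)" w] that v I by (auto simp: Ws_def \<phi>_def)
    qed
    then have inj: "inj_on X (span (v ` I))"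
      by (subst linear_injective_on_subspace_0[OF lin subspace_span]) blast
    then have "inj_on (X \<circ> v) I"
      using vI inj_on_subset[OF inj span_superset] by (intro comp_inj_on) auto
    moreover have "independent (X ` (v ` I))"
      using linear_independent_injective_image[OF lin vI(2) inj] .
    ultimately show "inj_on (X \<circ> v) I \<and> independent ((X \<circ> v) ` I)" by (simp add: image_comp)
  qed
  moreover have "range X \<subseteq> Rspace d" using lookX by (auto simp: Rspace_eq)
  ultimately show ?thesis using lin by blast
qed

text \<open>The boundary term disappears for two different reasons: for walks the coefficient is set
  to 0 after the last step, for bridges the total sum is 0.\<close>

lemma summation_by_parts:
  "(\<Sum>i=1..m. u i *\<^sub>R y i) =
    (\<Sum>k=1..m. (u k - u (Suc k)) *\<^sub>R partial_sum y k) + u (Suc m) *\<^sub>R partial_sum y m"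
  by (induction m) (simp_all add: partial_sum_def algebra_simps)

lemma any_independent_partial_sum:
  assumes "\<And>u k. (\<Sum>k=1..m. u k *\<^sub>R y k) = 0 \<Longrightarrow> k \<in> {1..m} \<Longrightarrow> u k = 0"
  shows "any_independent d m (partial_sum y)"
proof (rule any_independentI)
  fix u :: "nat \<Rightarrow> real" and k
  assume sum: "(\<Sum>k=1..m. u k *\<^sub>R partial_sum y k) = 0" and k: "k \<in> {1..m}"
  \<comment> \<open>Tail sums invert the differences in \<open>summation_by_parts\<close>, and
    \<open>w (Suc m) = 0\<close> removes its boundary term.\<close>
  define w where "w i = (\<Sum>k=i..m. u k)" for i
  have w: "w k = u k + w (Suc k)" if "k \<in> {1..m}" for k
    using that by (simp add: w_def sum.atLeast_Suc_atMost)
  have "(\<Sum>i=1..m. w i *\<^sub>R y i) = (\<Sum>k=1..m. (w k - w (Suc k)) *\<^sub>R partial_sum y k)"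
    by (subst summation_by_parts) (simp add: w_def)
  also have "\<dots> = (\<Sum>k=1..m. u k *\<^sub>R partial_sum y k)" using w by (intro sum.cong) auto
  finally have "(\<Sum>i=1..m. w i *\<^sub>R y i) = 0" using sum by simp
  then have "w i = 0" if "i \<in> {1..m}" for i using assms that by blast
  moreover have "w (Suc m) = 0" by (simp add: w_def)
  ultimately have "w k = 0" "w (Suc k) = 0" using k by (auto simp: le_Suc_eq not_less_eq_eq[symmetric])
    (metis One_nat_def Suc_le_eq atLeastAtMost_iff le_neq_implies_less zero_less_Suc)
  then show "u k = 0" using w[OF k] by simp
qed

lemma partial_sum_linear: "linear X \<Longrightarrow> partial_sum (X \<circ> y) k = X (partial_sum y k)"
  by (simp add: partial_sum_def linear_sum)

lemma partial_sum_in_Rspace: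
  "y ` {1..n} \<subseteq> Rspace d \<Longrightarrow> m \<le> n \<Longrightarrow> partial_sum y ` {1..m} \<subseteq> Rspace d"
  unfolding partial_sum_def by (auto intro!: subspace_sum[OF subspace_Rspace])

subsection \<open>Chambers\<close>

text \<open>Intended for lower bounds of the rank: at the index where a value occurs first, no
  earlier coordinate agrees with it, so no functional of that index vanishes.\<close>

lemma card_first_occurrences_le:
  fixes h :: "nat \<Rightarrow> 'b"
  assumes V: "V \<subseteq> h ` {1..n}"
    and P: "\<And>i. i \<in> {1..n} \<Longrightarrow> h i \<in> V \<Longrightarrow> (\<And>m. m \<in> {1..<i} \<Longrightarrow> h m \<noteq> h i) \<Longrightarrow> P i"
  shows "card V \<le> card {i \<in> {1..n}. P i}"
proof -
  define first where "first v = (LEAST i. i \<in> {1..n} \<and> h i = v)" for v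
  have first: "first v \<in> {1..n} \<and> h (first v) = v" if v: "v \<in> V" for v
  proof -
    obtain i where "i \<in> {1..n} \<and> h i = v" using V v by blast
    then show ?thesis unfolding first_def by (rule LeastI)
  qed
  have least: "h m \<noteq> v" if "m \<in> {1..<first v}" "v \<in> V" for m v
    using not_less_Least[of m "\<lambda>i. i \<in> {1..n} \<and> h i = v"] that first[of v] by (auto simp: first_def)
  have "P (first v)" if "v \<in> V" for v
    using first[OF that] least[OF _ that] that by (intro P) auto
  then have "first ` V \<subseteq> {i \<in> {1..n}. P i}" using first by blast
  then have "card (first ` V) \<le> card {i \<in> {1..n}. P i}" by (intro card_mono) auto
  moreover have "inj_on first V" using first by (metis inj_onI)
  ultimately show ?thesis by (simp add: card_image)
qed

text \<open>The values just before the descents are distinct, and all of them exceed the final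
  value. This bounds the number of nonzero walls by a number of distinct coordinates.\<close>

lemma card_descents_le:
  fixes u :: "nat \<Rightarrow> real"
  assumes mono: "\<And>i j. 1 \<le> i \<Longrightarrow> i \<le> j \<Longrightarrow> j \<le> Suc m \<Longrightarrow> u j \<le> u i"
  shows "card {k \<in> {1..m}. u k - u (Suc k) \<noteq> 0} \<le> card (u ` {1..m} - {u (Suc m)})"
proof -
  let ?D = "{k \<in> {1..m}. u k - u (Suc k) \<noteq> 0}"
  have lt: "u (Suc k) < u k" if "k \<in> ?D" for k using mono[of k "Suc k"] that by auto
  have "inj_on u ?D"
  proof (rule linorder_inj_onI)
    fix k l assume kl: "k < l" "k \<in> ?D" "l \<in> ?D"
    then have "u l \<le> u (Suc k)" by (intro mono) auto
    then show "u k \<noteq> u l" using lt[of k] kl by auto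
  qed auto
  moreover have "u ` ?D \<subseteq> u ` {1..m} - {u (Suc m)}"
  proof
    fix x assume "x \<in> u ` ?D"
    then obtain k where k: "k \<in> ?D" "x = u k" by blast
    then have "u (Suc m) \<le> u (Suc k)" by (intro mono) auto
    then show "x \<in> u ` {1..m} - {u (Suc m)}" using lt[OF k(1)] k by auto
  qed
  then have "card (u ` ?D) \<le> card (u ` {1..m} - {u (Suc m)})" by (intro card_mono) auto
  ultimately show ?thesis by (simp add: card_image)
qed

text \<open>Selection sort: a minimiser is transposed into the last position, and the induction
  hypothesis sorts the transposed function on the rest.\<close>

lemma ex_sorting_permutation:
  fixes h :: "nat \<Rightarrow> real"
  shows "\<exists>\<sigma>. \<sigma> permutes {1..n} \<and> (\<forall>i j. 1 \<le> i \<longrightarrow> i \<le> j \<longrightarrow> j \<le> n \<longrightarrow> h (\<sigma> j) \<le> h (\<sigma> i))"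
proof (induction n arbitrary: h)
  case 0
  show ?case by (intro exI[of _ id]) (auto simp: permutes_id)
next
  case (Suc n)
  define p where "p = arg_min_on h {1..Suc n}"
  have p: "p \<in> {1..Suc n}" "\<And>q. q \<in> {1..Suc n} \<Longrightarrow> h p \<le> h q"
    using arg_min_if_finite(1)[of "{1..Suc n}" h] arg_min_least[of "{1..Suc n}" _ h]
    by (auto simp: p_def)
  let ?t = "Transposition.transpose p (Suc n)"
  obtain \<sigma> where \<sigma>: "\<sigma> permutes {1..n}"
    "\<And>i j. 1 \<le> i \<Longrightarrow> i \<le> j \<Longrightarrow> j \<le> n \<Longrightarrow> (h \<circ> ?t) (\<sigma> j) \<le> (h \<circ> ?t) (\<sigma> i)"
    using Suc.IH[of "h \<circ> ?t"] by blast
  have t: "?t permutes {1..Suc n}" using p by (intro permutes_swap_id) auto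
  have \<sigma>': "\<sigma> permutes {1..Suc n}" using \<sigma>(1) by (rule permutes_subset) auto
  have perm: "(?t \<circ> \<sigma>) permutes {1..Suc n}" using permutes_compose[OF \<sigma>' t] .
  have "\<sigma> (Suc n) = Suc n" using \<sigma>(1) by (simp add: permutes_not_in)
  then have last: "(?t \<circ> \<sigma>) (Suc n) = p" by simp
  have "h ((?t \<circ> \<sigma>) j) \<le> h ((?t \<circ> \<sigma>) i)" if ij: "1 \<le> i" "i \<le> j" "j \<le> Suc n" for i j
  proof (cases "j = Suc n")
    case True
    have "(?t \<circ> \<sigma>) i \<in> {1..Suc n}" using permutes_in_image[OF perm, of i] ij by auto
    then show ?thesis using True last p(2) by simp
  next
    case False
    then show ?thesis using \<sigma>(2)[of i j] ij by simp
  qed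
  then show ?case using perm by blast
qed

lemma strictly_decreasing_on_interval:
  fixes u :: "nat \<Rightarrow> real"
  assumes "\<And>k. 1 \<le> k \<Longrightarrow> k < n \<Longrightarrow> u (Suc k) < u k" "1 \<le> i" "i < j" "j \<le> n"
  shows "u j < u i"
  using assms(3,4)
proof (induction j)
  case (Suc j)
  show ?case
  proof (cases "i = j")
    case True
    then show ?thesis using assms(1)[of j] assms(2) Suc.prems by simp
  next
    case False
    then have "u j < u i" "u (Suc j) < u j" using Suc assms(1)[of j] assms(2) by auto
    then show ?thesis by linarith
  qed
qed simp

lemma sorting_permutation_unique:
  fixes h :: "nat \<Rightarrow> real"
  assumes \<sigma>: "\<sigma> permutes {1..n}" "\<And>k. 1 \<le> k \<Longrightarrow> k < n \<Longrightarrow> h (\<sigma> (Suc k)) < h (\<sigma> k)"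
    and \<sigma>': "\<sigma>' permutes {1..n}" "\<And>k. 1 \<le> k \<Longrightarrow> k < n \<Longrightarrow> h (\<sigma>' (Suc k)) < h (\<sigma>' k)"
  shows "\<sigma> = \<sigma>'"
proof -
  \<comment> \<open>\<open>\<tau>\<close> compares the two orderings. Both are strictly decreasing,
    so it is an increasing permutation, hence the identity.\<close>
  define \<tau> where "\<tau> = inv \<sigma>' \<circ> \<sigma>"
  have \<tau>: "\<tau> permutes {1..n}"
    unfolding \<tau>_def by (rule permutes_compose[OF \<sigma>(1) permutes_inv[OF \<sigma>'(1)]])
  have eq: "\<sigma>' (\<tau> i) = \<sigma> i" for i
    using permutes_inverses(1)[OF \<sigma>'(1)] by (simp add: \<tau>_def)
  have step: "\<tau> i < \<tau> (Suc i)" if i: "1 \<le> i" "i < n" for i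
  proof (rule ccontr)
    assume "\<not> \<tau> i < \<tau> (Suc i)"
    then consider "\<tau> (Suc i) = \<tau> i" | "\<tau> (Suc i) < \<tau> i" by linarith
    then show False
    proof cases
      case 1
      then show False using injD[OF permutes_inj[OF \<tau>] 1] by simp
    next
      case 2
      have "\<tau> i \<in> {1..n}" "\<tau> (Suc i) \<in> {1..n}"
        using permutes_in_image[OF \<tau>] i by simp_all
      then have "h (\<sigma>' (\<tau> i)) < h (\<sigma>' (\<tau> (Suc i)))"
        using strictly_decreasing_on_interval[of n "\<lambda>k. h (\<sigma>' k)" "\<tau> (Suc i)" "\<tau> i"] \<sigma>'(2) 2 by auto
      then show False using \<sigma>(2)[OF i] by (simp add: eq)
    qed
  qed
  have "i \<le> \<tau> i" if "i \<in> {1..n}" for i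
    using that
  proof (induction i)
    case (Suc i)
    show ?case
    proof (cases "i = 0")
      case True
      then show ?thesis using permutes_in_image[OF \<tau>, of 1] Suc.prems by simp
    next
      case False
      then have "i \<le> \<tau> i" "\<tau> i < \<tau> (Suc i)" using Suc step[of i] by auto
      then show ?thesis by simp
    qed
  qed simp
  then have "\<tau> = id" using permutes_natset_ge[OF \<tau>] by blast
  then show ?thesis using eq by (auto simp: fun_eq_iff)
qed

section \<open>Chambers and regions\<close>

text \<open>\<open>C g c\<close> stands for membership of \<open>c\<close> in the open chamber of
  \<open>g\<close>. Signs are constant on a chamber, so any chosen point of it gives the same
  region, and that region determines \<open>g\<close>.\<close>

lemma card_chambers_eq_card_regions:
  assumes ex: "\<And>c. c \<in> A \<Longrightarrow> \<forall>r\<in>F. ev r c \<noteq> 0 \<Longrightarrow> \<exists>g\<in>G. C g c"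
    and nonzero: "\<And>g c r. g \<in> G \<Longrightarrow> c \<in> A \<Longrightarrow> C g c \<Longrightarrow> r \<in> F \<Longrightarrow> ev r c \<noteq> 0"
    and signs: "\<And>g c c' r. g \<in> G \<Longrightarrow> c \<in> A \<Longrightarrow> c' \<in> A \<Longrightarrow> C g c \<Longrightarrow> C g c' \<Longrightarrow> r \<in> F \<Longrightarrow>
      ev r c > 0 \<Longrightarrow> ev r c' > 0"
    and unique: "\<And>g g' c c'. g \<in> G \<Longrightarrow> g' \<in> G \<Longrightarrow> c \<in> A \<Longrightarrow> c' \<in> A \<Longrightarrow> C g c \<Longrightarrow> C g' c' \<Longrightarrow>
      {r \<in> F. ev r c > 0} = {r \<in> F. ev r c' > 0} \<Longrightarrow> g = g'"
  shows "card {g \<in> G. \<exists>c\<in>A. C g c} = card (regions ev A F)"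
proof -
  define pick where "pick g = (SOME c. c \<in> A \<and> C g c)" for g
  have pick: "pick g \<in> A \<and> C g (pick g)" if "\<exists>c\<in>A. C g c" for g
    unfolding pick_def by (rule someI_ex) (use that in blast)
  have "bij_betw (\<lambda>g. {r \<in> F. ev r (pick g) > 0}) {g \<in> G. \<exists>c\<in>A. C g c} (regions ev A F)"
  proof (rule bij_betw_imageI)
    show "inj_on (\<lambda>g. {r \<in> F. ev r (pick g) > 0}) {g \<in> G. \<exists>c\<in>A. C g c}"
    proof (rule inj_onI)
      fix g g' assume g: "g \<in> {g \<in> G. \<exists>c\<in>A. C g c}" and g': "g' \<in> {g \<in> G. \<exists>c\<in>A. C g c}"
        and eq: "{r \<in> F. ev r (pick g) > 0} = {r \<in> F. ev r (pick g') > 0}"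
      show "g = g'" by (rule unique[OF _ _ _ _ _ _ eq]) (use g g' pick in auto)
    qed
    show "(\<lambda>g. {r \<in> F. ev r (pick g) > 0}) ` {g \<in> G. \<exists>c\<in>A. C g c} = regions ev A F"
    proof
      show "(\<lambda>g. {r \<in> F. ev r (pick g) > 0}) ` {g \<in> G. \<exists>c\<in>A. C g c} \<subseteq> regions ev A F"
      proof
        fix S assume "S \<in> (\<lambda>g. {r \<in> F. ev r (pick g) > 0}) ` {g \<in> G. \<exists>c\<in>A. C g c}"
        then obtain g where g: "g \<in> G" "\<exists>c\<in>A. C g c" "S = {r \<in> F. ev r (pick g) > 0}" by blast
        then show "S \<in> regions ev A F"
          using pick[OF g(2)] nonzero[OF g(1)] regionsI[of "pick g" A F ev] by auto
      qed
      show "regions ev A F \<subseteq> (\<lambda>g. {r \<in> F. ev r (pick g) > 0}) ` {g \<in> G. \<exists>c\<in>A. C g c}"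
      proof
        fix S assume "S \<in> regions ev A F"
        then obtain c where c: "c \<in> A" "\<forall>r\<in>F. ev r c \<noteq> 0" "S = {r \<in> F. ev r c > 0}"
          by (rule regionsE)
        obtain g where g: "g \<in> G" "C g c" using ex c by blast
        have p: "pick g \<in> A" "C g (pick g)" using pick[of g] c g by auto
        have "S = {r \<in> F. ev r (pick g) > 0}"
          using c(3) signs[OF g(1) c(1) p(1) g(2) p(2)] signs[OF g(1) p(1) c(1) p(2) g(2)] by blast
        then show "S \<in> (\<lambda>g. {r \<in> F. ev r (pick g) > 0}) ` {g \<in> G. \<exists>c\<in>A. C g c}"
          using g c(1) by blast
      qed
    qed
  qed
  then show ?thesis by (rule bij_betw_same_card)
qed

text \<open>
  The closed chamber of \<open>g\<close> is the simplicial cone (up to a lineality space) given by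
  \<open>wall g k c \<ge> 0\<close>.
\<close>

locale chamber_system = root_family J off for J :: "nat \<Rightarrow> int set" and off :: nat +
  fixes n m :: nat and G :: "'g set" and wall :: "'g \<Rightarrow> nat \<Rightarrow> (nat \<Rightarrow> real) \<Rightarrow> real"
  assumes wall_root: "\<And>g k. g \<in> G \<Longrightarrow> k \<in> {1..m} \<Longrightarrow>
      \<exists>r\<in>roots n. \<exists>s. s \<noteq> 0 \<and> (\<forall>c. wall g k c = s * root_eval r c)"
    and root_nonzero: "\<And>g c r. g \<in> G \<Longrightarrow> \<forall>k\<in>{1..m}. 0 < wall g k c \<Longrightarrow> r \<in> roots n \<Longrightarrow>
      root_eval r c \<noteq> 0"
    and unique_chamber: "\<And>g g' c. g \<in> G \<Longrightarrow> g' \<in> G \<Longrightarrow> \<forall>k\<in>{1..m}. 0 < wall g k c \<Longrightarrow>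
      \<forall>k\<in>{1..m}. 0 < wall g' k c \<Longrightarrow> g = g'"
    and ex_chamber: "\<And>c. \<exists>g\<in>G. (\<forall>k\<in>{1..m}. 0 \<le> wall g k c) \<and>
      card {k \<in> {1..m}. wall g k c \<noteq> 0} + off \<le> rank n c"
    and rank_wall_zero: "\<And>g c. g \<in> G \<Longrightarrow> \<forall>k\<in>{1..m}. wall g k c = 0 \<Longrightarrow> rank n c \<le> off"
    and wall_surj: "\<And>g u. g \<in> G \<Longrightarrow> \<exists>c. \<forall>k\<in>{1..m}. wall g k c = u k"
begin

lemma wall_combination:
  assumes "g \<in> G" "k \<in> {1..m}"
  shows "wall g k (\<lambda>i. s * a i + t * b i) = s * wall g k a + t * wall g k b"
proof -
  obtain r q where "\<forall>c. wall g k c = q * root_eval r c" using wall_root[OF assms] by blast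
  then show ?thesis by (simp add: root_eval_combination algebra_simps)
qed

lemma card_chambers_meeting:
  "card {g \<in> G. \<exists>c\<in>kernel_space n K M. \<forall>k\<in>{1..m}. 0 < wall g k c} =
   card (regions root_eval (kernel_space n K M) (roots n))"
proof (rule card_chambers_eq_card_regions)
  fix c assume c: "\<forall>r\<in>roots n. root_eval r c \<noteq> 0"
  obtain g where g: "g \<in> G" "\<forall>k\<in>{1..m}. 0 \<le> wall g k c" using ex_chamber by blast
  have "wall g k c \<noteq> 0" if "k \<in> {1..m}" for k
    using wall_root[OF g(1) that] c by auto
  then show "\<exists>g\<in>G. \<forall>k\<in>{1..m}. 0 < wall g k c" using g by (intro bexI[of _ g]) (auto simp: less_le)
next
  fix g c c' r
  assume g: "g \<in> G" "\<forall>k\<in>{1..m}. 0 < wall g k c" "\<forall>k\<in>{1..m}. 0 < wall g k c'"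
    and r: "r \<in> roots n" "0 < root_eval r c"
  show "0 < root_eval r c'"
  proof (rule ccontr)
    assume "\<not> 0 < root_eval r c'"
    then have neg: "root_eval r c' < 0" using root_nonzero[OF g(1,3) r(1)] by linarith
    \<comment> \<open>A positive combination stays in the open chamber, while these weights make
      \<open>r\<close> vanish.\<close>
    let ?b = "\<lambda>i. (- root_eval r c') * c i + root_eval r c * c' i"
    have "0 < wall g k ?b" if "k \<in> {1..m}" for k
      unfolding wall_combination[OF g(1) that] using g(2,3) that neg r(2)
      by (intro add_pos_pos mult_pos_pos) auto
    then have "root_eval r ?b \<noteq> 0" using root_nonzero[OF g(1) _ r(1)] by blast
    moreover have "root_eval r ?b = 0" unfolding root_eval_combination by simp
    ultimately show False by contradiction
  qed
next
  fix g g' c c'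
  assume g: "g \<in> G" "g' \<in> G" "\<forall>k\<in>{1..m}. 0 < wall g k c" "\<forall>k\<in>{1..m}. 0 < wall g' k c'"
    and eq: "{r \<in> roots n. 0 < root_eval r c} = {r \<in> roots n. 0 < root_eval r c'}"
  have "0 < wall g k c'" if k: "k \<in> {1..m}" for k
  proof -
    obtain r s where r: "r \<in> roots n" "s \<noteq> 0" "\<And>c. wall g k c = s * root_eval r c"
      using wall_root[OF g(1) k] by blast
    have "root_eval r c > 0 \<longleftrightarrow> root_eval r c' > 0" using eq r(1) by blast
    moreover have "root_eval r c' \<noteq> 0" using root_nonzero[OF g(2,4) r(1)] .
    moreover have "0 < s * root_eval r c" using g(3) k unfolding r(3)[symmetric] by blast
    ultimately show ?thesis unfolding r(3) by (auto simp: zero_less_mult_iff)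
  qed
  then show "g = g'" using unique_chamber[OF g(1,2)] g(4) by blast
qed (use root_nonzero in blast)

text \<open>By \<open>rel\<close> the wall values of a kernel vector are the coefficients of a
  relation among the \<open>v g k\<close>. In the closed chamber supplied by
  \<open>ex_chamber\<close>, a kernel vector of rank at most \<open>d + off\<close> gives a relation
  among at most \<open>d\<close> vectors, hence a trivial one; this is how regularity becomes
  genericity.\<close>

theorem card_hull_contains_zero:
  fixes x :: "nat \<Rightarrow> rvec" and v :: "'g \<Rightarrow> nat \<Rightarrow> rvec"
  assumes x: "x ` {1..n} \<subseteq> Rspace d"
    and rel: "\<And>g c. g \<in> G \<Longrightarrow> (\<Sum>i=1..n. c i *\<^sub>R x i) = (\<Sum>k=1..m. wall g k c *\<^sub>R v g k)"
    and v: "\<And>g. g \<in> G \<Longrightarrow> v g ` {1..m} \<subseteq> Rspace d" "\<And>g. g \<in> G \<Longrightarrow> any_independent d m (v g)"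
    and d: "1 \<le> d" "d \<le> m" "d + off \<le> n"
  shows "card {g \<in> G. hull_contains_zero m (v g)} = chamber_number n d"
proof -
  define M where "M k i = Poly_Mapping.lookup (x i) k" for k i
  have kernel: "c \<in> kernel_space n {1..d} M \<longleftrightarrow> (\<Sum>i=1..n. c i *\<^sub>R x i) = 0" for c
    unfolding kernel_space_def M_def mem_Collect_eq
    using x by (subst combination_eq_zero_iff[of _ _ d]) auto
  have "generic n {1..d} M"
    unfolding generic_def
  proof
    fix c assume c: "c \<in> kernel_space n {1..d} M"
    obtain g where g: "g \<in> G" "card {k \<in> {1..m}. wall g k c \<noteq> 0} + off \<le> rank n c"
      using ex_chamber by blast
    show "rank n c \<le> off \<or> card {1..d} + off < rank n c"
    proof (rule ccontr)
      assume neg: "\<not> ?thesis"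
      let ?S = "{k \<in> {1..m}. wall g k c \<noteq> 0}"
      have card: "card ?S \<le> d" using neg g(2) by simp
      have "(\<Sum>k\<in>?S. wall g k c *\<^sub>R v g k) = (\<Sum>k=1..m. wall g k c *\<^sub>R v g k)"
        by (intro sum.mono_neutral_left) auto
      then have "(\<Sum>k\<in>?S. wall g k c *\<^sub>R v g k) = 0" using rel[OF g(1)] c kernel by metis
      then have "wall g k c = 0" if "k \<in> ?S" for k
        using any_independentD[OF v(2)[OF g(1)] d(2) _ card, of "\<lambda>k. wall g k c"] that by blast
      then have "\<forall>k\<in>{1..m}. wall g k c = 0" by blast
      then show False using rank_wall_zero[OF g(1)] neg by blast
    qed
  qed
  then have "chamber_number n d = card (regions root_eval (kernel_space n {1..d} M) (roots n))"
    using card_regions_generic[of "{1..d}" n M] d by simp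
  also have "\<dots> = card {g \<in> G. \<exists>c\<in>kernel_space n {1..d} M. \<forall>k\<in>{1..m}. 0 < wall g k c}"
    by (rule card_chambers_meeting[symmetric])
  also have "{g \<in> G. \<exists>c\<in>kernel_space n {1..d} M. \<forall>k\<in>{1..m}. 0 < wall g k c} =
      {g \<in> G. hull_contains_zero m (v g)}"
  proof (rule Collect_cong, rule conj_cong[OF refl])
    fix g assume g: "g \<in> G"
    have "hull_contains_zero m (v g) \<longleftrightarrow>
      (\<exists>u. (\<forall>k\<in>{1..m}. 0 < u k) \<and> (\<Sum>k=1..m. u k *\<^sub>R v g k) = 0)"
      using v g d by (intro hull_contains_zero_iff_positive) auto
    also have "\<dots> \<longleftrightarrow> (\<exists>c\<in>kernel_space n {1..d} M. \<forall>k\<in>{1..m}. 0 < wall g k c)"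
    proof
      assume "\<exists>u. (\<forall>k\<in>{1..m}. 0 < u k) \<and> (\<Sum>k=1..m. u k *\<^sub>R v g k) = 0"
      then obtain u where u: "\<forall>k\<in>{1..m}. 0 < u k" "(\<Sum>k=1..m. u k *\<^sub>R v g k) = 0" by blast
      \<comment> \<open>All coefficients occur as wall values, so a positive relation lifts to a
        point of the kernel.\<close>
      obtain c where c: "\<forall>k\<in>{1..m}. wall g k c = u k" using wall_surj[OF g] by blast
      have "(\<Sum>k=1..m. wall g k c *\<^sub>R v g k) = (\<Sum>k=1..m. u k *\<^sub>R v g k)"
        using c by (intro sum.cong) auto
      then have "c \<in> kernel_space n {1..d} M" using kernel rel[OF g] u by simp
      then show "\<exists>c\<in>kernel_space n {1..d} M. \<forall>k\<in>{1..m}. 0 < wall g k c"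
        using c u by (intro bexI[of _ c]) auto
    next
      assume "\<exists>c\<in>kernel_space n {1..d} M. \<forall>k\<in>{1..m}. 0 < wall g k c"
      then obtain c where "c \<in> kernel_space n {1..d} M" "\<forall>k\<in>{1..m}. 0 < wall g k c" by blast
      then show "\<exists>u. (\<forall>k\<in>{1..m}. 0 < u k) \<and> (\<Sum>k=1..m. u k *\<^sub>R v g k) = 0"
        using kernel rel[OF g] by (intro exI[of _ "\<lambda>k. wall g k c"]) simp
    qed
    finally show "(\<exists>c\<in>kernel_space n {1..d} M. \<forall>k\<in>{1..m}. 0 < wall g k c) \<longleftrightarrow>
      hull_contains_zero m (v g)" by blast
  qed
  finally show ?thesis by simp
qed

end

lemma signsD: "\<epsilon> \<in> signs n \<Longrightarrow> k \<in> {1..n} \<Longrightarrow> \<epsilon> k = 1 \<or> \<epsilon> k = -1"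
  by (auto simp: signs_def PiE_iff)

lemma sign_square: "\<epsilon> \<in> signs n \<Longrightarrow> k \<in> {1..n} \<Longrightarrow> \<epsilon> k * \<epsilon> k = 1"
  using signsD[of \<epsilon> n k] by auto

lemma finite_signs: "finite (signs n)"
  by (simp add: signs_def finite_PiE)

lemma sign_vector_in_signs: "(\<lambda>k\<in>{1..n}. if P k then 1 else -1) \<in> signs n"
  by (auto simp: signs_def)

lemma signs_eqI:
  assumes "\<epsilon> \<in> signs n" "\<epsilon>' \<in> signs n" "\<And>k. k \<in> {1..n} \<Longrightarrow> 0 < \<epsilon> k * c k \<and> 0 < \<epsilon>' k * c k"
  shows "\<epsilon> = \<epsilon>'"
proof (rule PiE_ext)
  show "\<epsilon> \<in> {1..n} \<rightarrow>\<^sub>E {-1, 1}" "\<epsilon>' \<in> {1..n} \<rightarrow>\<^sub>E {-1, 1}" using assms by (simp_all add: signs_def)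
  show "\<epsilon> k = \<epsilon>' k" if "k \<in> {1..n}" for k
    using signsD[OF assms(1) that] signsD[OF assms(2) that] assms(3)[OF that] by auto
qed

text \<open>The witness \<open>a\<close> makes the description unique; with no regular configuration
  every \<open>N\<close> would satisfy it vacuously.\<close>

lemma the_common_value:
  assumes "P a" "\<And>x. P x \<Longrightarrow> f x = N"
  shows "(THE N. \<forall>x. P x \<longrightarrow> f x = N) = N"
  using assms by (intro the_equality) auto

lemma in_permutation_range:
  assumes "\<sigma> permutes {1..n}" "p \<in> {1..n}"
  obtains k where "k \<in> {1..n}" "\<sigma> k = p"
  using permutes_image[OF assms(1)] assms(2) by (metis imageE)

lemma constant_on_interval:
  "(\<And>k. k \<in> {1..m} \<Longrightarrow> u k = u (Suc k)) \<Longrightarrow> 1 \<le> i \<Longrightarrow> i \<le> Suc m \<Longrightarrow> u i = u (Suc m)"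
proof (induction m)
  case (Suc m)
  show ?case
  proof (cases "i = Suc (Suc m)")
    case False
    then have "u i = u (Suc m)" using Suc by auto
    then show ?thesis using Suc.prems(1)[of "Suc m"] by simp
  qed simp
qed simp

text \<open>The starting point for all regular configurations: its columns are independent in
  dimension \<open>n\<close>, and a generic linear map brings them down to dimension
  \<open>d\<close>.\<close>

definition unit_config :: "nat \<Rightarrow> rvec" where
  "unit_config i = Poly_Mapping.single i 1"

lemma lookup_unit_config: "Poly_Mapping.lookup (unit_config i) k = (if i = k then 1 else 0)"
  by (simp add: unit_config_def lookup_single when_def)

lemma unit_config_in_Rspace: "i \<in> {1..n} \<Longrightarrow> unit_config i \<in> Rspace n"
  by (auto simp: Rspace_eq lookup_unit_config)

subsection \<open>Wendel's model\<close>

text \<open>Each index carries the single hyperplane where that coordinate vanishes, so the closure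
  condition is vacuous.\<close>

interpretation wendel: root_family "\<lambda>_. {0}" 0
  by unfold_locales auto

lemma wendel_rank: "wendel.rank n c = card {i \<in> {1..n}. c i \<noteq> 0}"
  by (simp add: wendel.rank_def root_eval_def)

lemma wendel_chamber_system: "chamber_system (\<lambda>_. {0}) 0 n n (signs n) (\<lambda>\<epsilon> k c. \<epsilon> k * c k)"
proof unfold_locales
  fix \<epsilon> :: "nat \<Rightarrow> real" and k assume \<epsilon>: "\<epsilon> \<in> signs n" and k: "k \<in> {1..n}"
  show "\<exists>r\<in>wendel.roots n. \<exists>s. s \<noteq> 0 \<and> (\<forall>c. \<epsilon> k * c k = s * root_eval r c)"
    using signsD[OF \<epsilon> k] k
    by (intro bexI[of _ "(k, 0)"] exI[of _ "\<epsilon> k"]) (auto simp: wendel.roots_def root_eval_def)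
next
  fix \<epsilon> c :: "nat \<Rightarrow> real" and r
  assume "\<forall>k\<in>{1..n}. 0 < \<epsilon> k * c k" "r \<in> wendel.roots n"
  then show "root_eval r c \<noteq> 0" by (fastforce simp: wendel.roots_def root_eval_def)
next
  fix \<epsilon> \<epsilon>' c :: "nat \<Rightarrow> real"
  assume "\<epsilon> \<in> signs n" "\<epsilon>' \<in> signs n"
    "\<forall>k\<in>{1..n}. 0 < \<epsilon> k * c k" "\<forall>k\<in>{1..n}. 0 < \<epsilon>' k * c k"
  then show "\<epsilon> = \<epsilon>'" by (intro signs_eqI[of \<epsilon> n \<epsilon>' c]) auto
next
  fix c :: "nat \<Rightarrow> real"
  \<comment> \<open>A vanishing coordinate is compatible with both signs; 1 is an arbitrary
    choice.\<close>
  let ?\<epsilon> = "\<lambda>k\<in>{1..n}. if c k \<ge> 0 then 1 else -1::real"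
  have "card {k \<in> {1..n}. ?\<epsilon> k * c k \<noteq> 0} \<le> card {i \<in> {1..n}. c i \<noteq> 0}"
    by (intro card_mono) auto
  then show "\<exists>\<epsilon>\<in>signs n. (\<forall>k\<in>{1..n}. 0 \<le> \<epsilon> k * c k) \<and>
      card {k \<in> {1..n}. \<epsilon> k * c k \<noteq> 0} + 0 \<le> wendel.rank n c"
    using sign_vector_in_signs[where n = n and P = "\<lambda>k. c k \<ge> 0"] by (intro bexI[of _ ?\<epsilon>]) (auto simp: wendel_rank)
next
  fix \<epsilon> c :: "nat \<Rightarrow> real"
  assume \<epsilon>: "\<epsilon> \<in> signs n" and zero: "\<forall>k\<in>{1..n}. \<epsilon> k * c k = 0"
  have "{i \<in> {1..n}. c i \<noteq> 0} = {}" using zero signsD[OF \<epsilon>] by fastforce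
  then show "wendel.rank n c \<le> 0" unfolding wendel_rank by simp
next
  fix \<epsilon> u :: "nat \<Rightarrow> real"
  assume "\<epsilon> \<in> signs n"
  then show "\<exists>c. \<forall>k\<in>{1..n}. \<epsilon> k * c k = u k"
    by (intro exI[of _ "\<lambda>k. \<epsilon> k * u k"]) (simp add: mult.assoc[symmetric] sign_square)
qed

lemma any_independent_signs:
  assumes v: "any_independent d n v" and \<epsilon>: "\<epsilon> \<in> signs n"
  shows "any_independent d n (\<lambda>i. \<epsilon> i *\<^sub>R v i)"
  unfolding any_independent_def
proof (intro allI impI)
  fix I assume I: "I \<subseteq> {1..n}" "card I = d"
  have fin: "finite I" using I finite_subset by auto
  have ind: "\<And>u k. (\<Sum>k\<in>I. u k *\<^sub>R v k) = 0 \<Longrightarrow> k \<in> I \<Longrightarrow> u k = 0"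
    using v I fin independent_family_iff[of I v] unfolding any_independent_def by blast
  have "u k = 0" if sum: "(\<Sum>k\<in>I. u k *\<^sub>R (\<epsilon> k *\<^sub>R v k)) = 0" and k: "k \<in> I" for u k
  proof -
    have "u k * \<epsilon> k = 0" using ind[of "\<lambda>k. u k * \<epsilon> k" k] sum k by simp
    then show ?thesis using signsD[OF \<epsilon>, of k] k I by auto
  qed
  then show "inj_on (\<lambda>i. \<epsilon> i *\<^sub>R v i) I \<and> independent ((\<lambda>i. \<epsilon> i *\<^sub>R v i) ` I)"
    using independent_family_iff[OF fin] by blast
qed

lemma wendel_count_regular:
  assumes x: "wendel_regular n d x" and d: "1 \<le> d" "d \<le> n"
  shows "wendel_count n x = wendel.chamber_number n d"
proof -
  interpret chamber_system "\<lambda>_. {0}" 0 n n "signs n" "\<lambda>\<epsilon> k c. \<epsilon> k * c k"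
    by (rule wendel_chamber_system)
  have R: "x ` {1..n} \<subseteq> Rspace d" "any_independent d n x" using x by (auto simp: wendel_regular_def)
  show ?thesis unfolding wendel_count_def
  proof (rule card_hull_contains_zero[OF R(1)])
    fix \<epsilon> c :: "nat \<Rightarrow> real" assume \<epsilon>: "\<epsilon> \<in> signs n"
    show "(\<Sum>i=1..n. c i *\<^sub>R x i) = (\<Sum>k=1..n. (\<epsilon> k * c k) *\<^sub>R (\<epsilon> k *\<^sub>R x k))"
      using sign_square[OF \<epsilon>] by (intro sum.cong) (auto simp: mult.assoc mult.commute[of "c _"])
    show "(\<lambda>i. \<epsilon> i *\<^sub>R x i) ` {1..n} \<subseteq> Rspace d"
      using R(1) by (auto intro!: subspace_scale[OF subspace_Rspace])
    show "any_independent d n (\<lambda>i. \<epsilon> i *\<^sub>R x i)" using any_independent_signs[OF R(2) \<epsilon>] .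
  qed (use d in auto)
qed

lemma unit_combination_eq_zero:
  assumes "\<sigma> permutes {1..n}" "(\<Sum>k=1..n. u k *\<^sub>R unit_config (\<sigma> k)) = 0" "k \<in> {1..n}"
  shows "u k = 0"
proof -
  have "\<sigma> i = \<sigma> k \<longleftrightarrow> i = k" for i using inj_eq[OF permutes_inj[OF assms(1)]] by blast
  then have "Poly_Mapping.lookup (\<Sum>i=1..n. u i *\<^sub>R unit_config (\<sigma> i)) (\<sigma> k) =
      (\<Sum>i=1..n. if i = k then u i else 0)"
    by (simp add: lookup_sum lookup_unit_config if_distrib cong: if_cong)
  then show ?thesis using assms by (simp add: sum.delta)
qed

lemma ex_wendel_regular: "\<exists>x. wendel_regular n d x"
proof -
  have "any_independent d n unit_config"
    by (rule any_independentI) (use unit_combination_eq_zero[of id n] in \<open>simp add: permutes_id\<close>)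
  moreover have "unit_config ` {1..n} \<subseteq> Rspace n" using unit_config_in_Rspace by blast
  ultimately obtain X where X: "range X \<subseteq> Rspace d" "any_independent d n (X \<circ> unit_config)"
    using generic_linear_map[of "{unit_config}" d n n] by auto
  have "(X \<circ> unit_config) ` {1..n} \<subseteq> Rspace d" using X(1) by auto
  then show ?thesis unfolding wendel_regular_def using X(2) by blast
qed

lemma wendel_chamber_number_0: "wendel.chamber_number n 0 = 2 ^ n"
  by (induction n) auto

text \<open>The boundary conventions are values of \<open>chamber_number\<close>: all chambers for
  \<open>d = 0\<close>, and none for \<open>d = n\<close>, where a kernel in general position is
  zero on \<open>{1..n}\<close>.\<close>

lemma N_Wend_eq:
  assumes "1 \<le> n" "d \<le> n"
  shows "N_Wend n d = wendel.chamber_number n d"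
proof -
  consider "d = 0" | "1 \<le> d" "d = n" | "1 \<le> d" "d < n" using assms by linarith
  then show ?thesis
  proof cases
    case 1
    then show ?thesis by (simp add: N_Wend_def wendel_chamber_number_0)
  next
    case 2
    then show ?thesis by (cases n) (auto simp: N_Wend_def)
  next
    case 3
    obtain x where x: "wendel_regular n d x" using ex_wendel_regular by blast
    have "(THE N. \<forall>x. wendel_regular n d x \<longrightarrow> wendel_count n x = N) = wendel.chamber_number n d"
      by (rule the_common_value[of "wendel_regular n d", OF x]) (use wendel_count_regular 3 in auto)
    then show ?thesis using 3 by (simp add: N_Wend_def)
  qed
qed

subsection \<open>Random walks\<close>

text \<open>Index 0 and both signs of every smaller coordinate make \<open>2 * i - 1\<close>
  hyperplanes: the step from type B of rank \<open>i - 1\<close> to rank \<open>i\<close>.\<close>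

definition walk_indices :: "nat \<Rightarrow> int set" where
  "walk_indices i = {j. \<bar>j\<bar> < int i}"

lemma in_walk_indices [simp]: "j \<in> walk_indices i \<longleftrightarrow> \<bar>j\<bar> < int i"
  by (simp add: walk_indices_def)

lemma card_walk_indices_Suc: "card (walk_indices (Suc n)) = 2 * n + 1"
proof -
  have "walk_indices (Suc n) = {- int n..int n}" by auto
  then show ?thesis by (simp add: nat_add_distrib)
qed

interpretation walk: root_family walk_indices 0
proof unfold_locales
  fix i :: nat and j k :: int
  assume i: "1 \<le> i" and j: "j \<in> walk_indices i" and k: "k \<in> walk_indices i"
    and ne: "j \<noteq> k"
  \<comment> \<open>The entry of larger absolute index becomes the leading coordinate; the factor
    \<open>sgn j\<close> makes its coefficient positive.\<close>
  have larger: "\<exists>i'\<in>{1..<i}. \<exists>j'\<in>walk_indices i'. \<exists>s. s \<noteq> 0 \<and>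
      (\<forall>c. signed_entry c j - signed_entry c k = s * root_eval (i', j') c)"
    if j: "\<bar>j\<bar> < int i" and jk: "\<bar>k\<bar> < \<bar>j\<bar>" for j k
  proof (intro bexI exI conjI allI)
    show "nat \<bar>j\<bar> \<in> {1..<i}" using j jk by auto
    show "sgn j * k \<in> walk_indices (nat \<bar>j\<bar>)"
      using jk by (cases "j > 0") auto
    show "(of_int (sgn j) :: real) \<noteq> 0" using jk by (auto simp: sgn_if)
    show "signed_entry c j - signed_entry c k = of_int (sgn j) * root_eval (nat \<bar>j\<bar>, sgn j * k) c" for c
      using jk by (cases "j > 0") (auto simp: root_eval_def signed_entry_def)
  qed
  consider "\<bar>k\<bar> < \<bar>j\<bar>" | "\<bar>j\<bar> < \<bar>k\<bar>" | "k = - j" "j \<noteq> 0" using ne by linarith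
  then show "\<exists>i'\<in>{1..<i}. \<exists>j'\<in>walk_indices i'. \<exists>s. s \<noteq> 0 \<and>
      (\<forall>c. signed_entry c j - signed_entry c k = s * root_eval (i', j') c)"
  proof cases
    case 1
    then show ?thesis using larger[of j k] j i by auto
  next
    case 2
    then obtain i' j' s where *: "i' \<in> {1..<i}" "j' \<in> walk_indices i'" "s \<noteq> 0"
      "\<And>c. signed_entry c k - signed_entry c j = s * root_eval (i', j') c"
      using larger[of k j] k i by (auto simp: abs_less_iff)
    have "signed_entry c j - signed_entry c k = (- s) * root_eval (i', j') c" for c
      using *(4)[of c] by simp
    then show ?thesis using *(1-3) by (intro bexI[of _ i'] bexI[of _ j'] exI[of _ "- s"]) auto
  next
    case 3
    \<comment> \<open>Opposite entries differ by twice one coordinate, so the lower hyperplane is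
      the one where that coordinate vanishes.\<close>
    have "signed_entry c j - signed_entry c k = (2 * of_int (sgn j)) * root_eval (nat \<bar>j\<bar>, 0) c" for c
      using 3 by (simp add: root_eval_def signed_entry_def)
    then show ?thesis using 3 i j
      by (intro bexI[of _ "nat \<bar>j\<bar>"] bexI[of _ 0] exI[of _ "2 * of_int (sgn j)"]) (auto simp: sgn_if)
  qed
qed auto

text \<open>The value \<open>0\<close> at \<open>n + 1\<close> makes the last wall of a chamber a difference like the others.\<close>

definition walk_coord :: "nat \<Rightarrow> (nat \<Rightarrow> nat) \<times> (nat \<Rightarrow> real) \<Rightarrow> (nat \<Rightarrow> real) \<Rightarrow> nat \<Rightarrow> real" where
  "walk_coord n g c i = (if i \<le> n then snd g i * c (fst g i) else 0)"

lemma signed_permsD: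
  "g \<in> signed_perms n \<Longrightarrow> fst g permutes {1..n}" "g \<in> signed_perms n \<Longrightarrow> snd g \<in> signs n"
  by (auto simp: signed_perms_def)

lemma finite_signed_perms: "finite (signed_perms n)"
  by (simp add: signed_perms_def finite_signs finite_permutations)

lemma walk_wall_root:
  assumes g: "g \<in> signed_perms n" and k: "k \<in> {1..n}"
  shows "\<exists>r\<in>walk.roots n. \<exists>s. s \<noteq> 0 \<and>
    (\<forall>c. walk_coord n g c k - walk_coord n g c (Suc k) = s * root_eval r c)"
proof -
  let ?e = "snd g k"
  let ?p = "fst g k"
  note perm = signed_permsD(1)[OF g] and sgs = signed_permsD(2)[OF g]
  have p: "?p \<in> {1..n}" using permutes_in_image[OF perm] k by simp
  have e: "?e = 1 \<or> ?e = -1" using signsD[OF sgs k] .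
  show ?thesis
  proof (cases "k = n")
    case True
    have "walk_coord n g c k - walk_coord n g c (Suc k) = ?e * root_eval (?p, 0) c" for c
      using True by (simp add: walk_coord_def root_eval_def)
    moreover have "(?p, 0) \<in> walk.roots n" using p by (auto simp: walk.roots_def)
    moreover have "?e \<noteq> 0" using e by auto
    ultimately show ?thesis by blast
  next
    case False
    let ?f = "snd g (Suc k)"
    let ?q = "fst g (Suc k)"
    have k': "Suc k \<in> {1..n}" using False k by auto
    have q: "?q \<in> {1..n}" using permutes_in_image[OF perm] k' by simp
    have f: "?f = 1 \<or> ?f = -1" using signsD[OF sgs k'] .
    have "?p \<noteq> ?q" using inj_eq[OF permutes_inj[OF perm]] by simp
    have diff: "walk_coord n g c k - walk_coord n g c (Suc k) = ?e * c ?p - ?f * c ?q" for c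
      using k k' by (simp add: walk_coord_def)
    show ?thesis
    proof (cases "?q < ?p")
      case True
      \<comment> \<open>The larger index leads. Factoring out its sign leaves the other coordinate
        with the product of both signs.\<close>
      let ?j = "if ?e = ?f then int ?q else - int ?q"
      have "walk_coord n g c k - walk_coord n g c (Suc k) = ?e * root_eval (?p, ?j) c" for c
        unfolding diff using e f q by (auto simp: root_eval_def)
      moreover have "(?p, ?j) \<in> walk.roots n" using p True by (auto simp: walk.roots_def)
      moreover have "?e \<noteq> 0" using e by auto
      ultimately show ?thesis by blast
    next
      case False
      let ?j = "if ?e = ?f then int ?p else - int ?p"
      have "walk_coord n g c k - walk_coord n g c (Suc k) = (- ?f) * root_eval (?q, ?j) c" for c
        unfolding diff using e f p by (auto simp: root_eval_def)
      moreover have "(?q, ?j) \<in> walk.roots n"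
        using p q False \<open>?p \<noteq> ?q\<close> by (auto simp: walk.roots_def)
      moreover have "- ?f \<noteq> 0" using f by auto
      ultimately show ?thesis by blast
    qed
  qed
qed

lemma abs_walk_coord:
  assumes "g \<in> signed_perms n" "i \<in> {1..n}"
  shows "\<bar>walk_coord n g c i\<bar> = \<bar>c (fst g i)\<bar>"
  using signsD[OF signed_permsD(2)[OF assms(1)] assms(2)] assms(2)
  by (auto simp: walk_coord_def abs_mult)

lemma walk_coord_decreasing:
  assumes pos: "\<forall>k\<in>{1..n}. 0 < walk_coord n g c k - walk_coord n g c (Suc k)"
    and ij: "1 \<le> i" "i < j" "j \<le> Suc n"
  shows "walk_coord n g c j < walk_coord n g c i"
  by (rule strictly_decreasing_on_interval[of "Suc n"]) (use pos ij in auto)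

lemma walk_coord_pos:
  assumes "\<forall>k\<in>{1..n}. 0 < walk_coord n g c k - walk_coord n g c (Suc k)" "i \<in> {1..n}"
  shows "0 < walk_coord n g c i"
  using walk_coord_decreasing[OF assms(1), of i "Suc n"] assms(2) by (auto simp: walk_coord_def)

text \<open>In an open chamber the absolute values of the coordinates are positive and pairwise
  distinct, whereas a vanishing root would make one of them 0 or two of them equal.\<close>

lemma walk_root_nonzero:
  assumes g: "g \<in> signed_perms n"
    and pos: "\<forall>k\<in>{1..n}. 0 < walk_coord n g c k - walk_coord n g c (Suc k)"
    and r: "r \<in> walk.roots n"
  shows "root_eval r c \<noteq> 0"
proof
  assume zero: "root_eval r c = 0"
  note perm = signed_permsD(1)[OF g]
  obtain i j where ij: "r = (i, j)" "i \<in> {1..n}" "\<bar>j\<bar> < int i" using r by (auto simp: walk.roots_def)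
  obtain a where a: "a \<in> {1..n}" "fst g a = i" using in_permutation_range[OF perm ij(2)] .
  have abs: "\<bar>c i\<bar> = walk_coord n g c a"
    using abs_walk_coord[OF g a(1), of c] walk_coord_pos[OF pos a(1)] a(2) by simp
  show False
  proof (cases "j = 0")
    case True
    then show False using zero abs walk_coord_pos[OF pos a(1)] ij(1) by (simp add: root_eval_def)
  next
    case False
    then have "nat \<bar>j\<bar> \<in> {1..n}" using ij by auto
    then obtain b where b: "b \<in> {1..n}" "fst g b = nat \<bar>j\<bar>" using in_permutation_range[OF perm] by blast
    have "\<bar>c (nat \<bar>j\<bar>)\<bar> = walk_coord n g c b"
      using abs_walk_coord[OF g b(1), of c] walk_coord_pos[OF pos b(1)] b(2) by simp
    moreover have "\<bar>c i\<bar> = \<bar>c (nat \<bar>j\<bar>)\<bar>"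
      using zero ij(1) False by (auto simp: root_eval_def signed_entry_def abs_mult sgn_if)
    ultimately have "walk_coord n g c a = walk_coord n g c b" using abs by simp
    moreover have "a \<noteq> b" using a(2) b(2) ij by auto
    ultimately show False
      using walk_coord_decreasing[OF pos, of a b] walk_coord_decreasing[OF pos, of b a] a(1) b(1)
      by (cases "a < b") auto
  qed
qed

text \<open>The strict order of the absolute values fixes the permutation, and then positivity of
  the signed coordinates fixes the signs.\<close>

lemma walk_unique_chamber:
  assumes g: "g \<in> signed_perms n" "g' \<in> signed_perms n"
    and pos: "\<forall>k\<in>{1..n}. 0 < walk_coord n g c k - walk_coord n g c (Suc k)"
      "\<forall>k\<in>{1..n}. 0 < walk_coord n g' c k - walk_coord n g' c (Suc k)"
  shows "g = g'"
proof -
  have decr: "\<bar>c (fst h (Suc k))\<bar> < \<bar>c (fst h k)\<bar>"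
    if h: "h \<in> signed_perms n"
      "\<forall>k\<in>{1..n}. 0 < walk_coord n h c k - walk_coord n h c (Suc k)" and k: "1 \<le> k" "k < n" for h k
    using abs_walk_coord[OF h(1), of k c] abs_walk_coord[OF h(1), of "Suc k" c] k
      walk_coord_pos[OF h(2), of k] walk_coord_pos[OF h(2), of "Suc k"]
      walk_coord_decreasing[OF h(2), of k "Suc k"] by auto
  have fst_eq: "fst g = fst g'"
    by (rule sorting_permutation_unique[of _ n "\<lambda>p. \<bar>c p\<bar>"])
      (use g pos decr signed_permsD in auto)
  moreover have "snd g = snd g'"
  proof (rule signs_eqI[of _ n _ "\<lambda>k. c (fst g k)"])
    show "0 < snd g k * c (fst g k) \<and> 0 < snd g' k * c (fst g k)" if "k \<in> {1..n}" for k
      using walk_coord_pos[OF pos(1) that] walk_coord_pos[OF pos(2) that] that fst_eq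
      by (simp add: walk_coord_def)
  qed (use g signed_permsD in auto)
  ultimately show ?thesis by (simp add: prod_eq_iff)
qed

lemma walk_rank_ge: "card ((\<lambda>p. \<bar>c p\<bar>) ` {1..n} - {0}) \<le> walk.rank n c"
  unfolding walk.rank_def
proof (rule card_first_occurrences_le)
  fix i assume i: "i \<in> {1..n}" "\<bar>c i\<bar> \<in> (\<lambda>p. \<bar>c p\<bar>) ` {1..n} - {0}"
    and first: "\<And>m. m \<in> {1..<i} \<Longrightarrow> \<bar>c m\<bar> \<noteq> \<bar>c i\<bar>"
  show "\<forall>j\<in>walk_indices i. root_eval (i, j) c \<noteq> 0"
  proof
    fix j assume j: "j \<in> walk_indices i"
    show "root_eval (i, j) c \<noteq> 0"
    proof (cases "j = 0")
      case True
      then show ?thesis using i(2) by (simp add: root_eval_def)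
    next
      case False
      then have "nat \<bar>j\<bar> \<in> {1..<i}" using j by auto
      then have "\<bar>c (nat \<bar>j\<bar>)\<bar> \<noteq> \<bar>c i\<bar>" by (rule first)
      then show ?thesis using False by (auto simp: root_eval_def signed_entry_def sgn_if)
    qed
  qed
qed auto

text \<open>Sorting by absolute value and choosing signs that make all coordinates nonnegative gives
  the chamber. Its nonzero walls are descents, at most as many as there are distinct nonzero
  absolute values.\<close>

lemma walk_ex_chamber:
  "\<exists>g\<in>signed_perms n. (\<forall>k\<in>{1..n}. 0 \<le> walk_coord n g c k - walk_coord n g c (Suc k)) \<and>
    card {k \<in> {1..n}. walk_coord n g c k - walk_coord n g c (Suc k) \<noteq> 0} + 0 \<le> walk.rank n c"
proof -
  obtain \<sigma> where \<sigma>: "\<sigma> permutes {1..n}"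
    "\<And>i j. 1 \<le> i \<Longrightarrow> i \<le> j \<Longrightarrow> j \<le> n \<Longrightarrow> \<bar>c (\<sigma> j)\<bar> \<le> \<bar>c (\<sigma> i)\<bar>"
    using ex_sorting_permutation[of n "\<lambda>p. \<bar>c p\<bar>"] by blast
  define g where "g = (\<sigma>, \<lambda>k\<in>{1..n}. if 0 \<le> c (\<sigma> k) then 1 else -1 :: real)"
  have g: "g \<in> signed_perms n"
    using \<sigma>(1) sign_vector_in_signs[where n = n and P = "\<lambda>k. 0 \<le> c (\<sigma> k)"]
    by (simp add: g_def signed_perms_def)
  have coord: "walk_coord n g c i = \<bar>c (\<sigma> i)\<bar>" if "i \<in> {1..n}" for i
    using that by (auto simp: walk_coord_def g_def)
  have last: "walk_coord n g c (Suc n) = 0" by (simp add: walk_coord_def)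
  have mono: "walk_coord n g c j \<le> walk_coord n g c i" if "1 \<le> i" "i \<le> j" "j \<le> Suc n" for i j
  proof (cases "j = Suc n")
    case True
    then show ?thesis using that last coord[of i] by (cases "i = Suc n") auto
  next
    case False
    then show ?thesis using that coord[of i] coord[of j] \<sigma>(2)[of i j] by auto
  qed
  have "walk_coord n g c ` {1..n} = (\<lambda>i. \<bar>c (\<sigma> i)\<bar>) ` {1..n}"
    using coord by (intro image_cong) auto
  also have "\<dots> = (\<lambda>p. \<bar>c p\<bar>) ` (\<sigma> ` {1..n})" by (simp add: image_image)
  finally have image: "walk_coord n g c ` {1..n} = (\<lambda>p. \<bar>c p\<bar>) ` {1..n}"
    using permutes_image[OF \<sigma>(1)] by simp
  have "card {k \<in> {1..n}. walk_coord n g c k - walk_coord n g c (Suc k) \<noteq> 0} \<le>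
      card (walk_coord n g c ` {1..n} - {walk_coord n g c (Suc n)})"
    by (rule card_descents_le) (rule mono)
  also have "\<dots> \<le> walk.rank n c" unfolding image last by (rule walk_rank_ge)
  finally show ?thesis using g mono by (intro bexI[of _ g]) auto
qed

lemma walk_rank_zero:
  assumes g: "g \<in> signed_perms n"
    and zero: "\<forall>k\<in>{1..n}. walk_coord n g c k - walk_coord n g c (Suc k) = 0"
  shows "walk.rank n c \<le> 0"
proof -
  have "c p = 0" if p: "p \<in> {1..n}" for p
  proof -
    obtain a where a: "a \<in> {1..n}" "fst g a = p"
      using in_permutation_range[OF signed_permsD(1)[OF g] p] .
    have "walk_coord n g c a = walk_coord n g c (Suc n)"
      by (rule constant_on_interval) (use zero a in auto)
    then show ?thesis using abs_walk_coord[OF g a(1), of c] a(2) by (simp add: walk_coord_def)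
  qed
  then have "\<exists>j\<in>walk_indices i. root_eval (i, j) c = 0" if "i \<in> {1..n}" for i
    using that by (intro bexI[of _ 0]) (auto simp: root_eval_def)
  then have "{i \<in> {1..n}. \<forall>j\<in>walk_indices i. root_eval (i, j) c \<noteq> 0} = {}" by blast
  then show ?thesis unfolding walk.rank_def by simp
qed

lemma walk_wall_surj:
  assumes g: "g \<in> signed_perms n"
  shows "\<exists>c. \<forall>k\<in>{1..n}. walk_coord n g c k - walk_coord n g c (Suc k) = u k"
proof -
  note perm = signed_permsD(1)[OF g]
  \<comment> \<open>Tail sums have the prescribed differences; \<open>c\<close> transports them back
    through \<open>g\<close>, each sign being its own inverse.\<close>
  define w where "w i = (\<Sum>k=i..n. u k)" for i
  define c where "c p = snd g (inv (fst g) p) * w (inv (fst g) p)" for p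
  have "walk_coord n g c i = w i" if "i \<in> {1..Suc n}" for i
    using that sign_square[OF signed_permsD(2)[OF g], of i] permutes_inverses(2)[OF perm]
    by (auto simp: walk_coord_def c_def w_def mult.assoc[symmetric])
  then have "walk_coord n g c k - walk_coord n g c (Suc k) = u k" if "k \<in> {1..n}" for k
    using that by (simp add: w_def sum.atLeast_Suc_atMost)
  then show ?thesis by blast
qed

lemma walk_chamber_system:
  "chamber_system walk_indices 0 n n (signed_perms n)
    (\<lambda>g k c. walk_coord n g c k - walk_coord n g c (Suc k))"
  by unfold_locales (rule walk_wall_root walk_root_nonzero walk_unique_chamber walk_ex_chamber
    walk_rank_zero walk_wall_surj; assumption)+

lemma walk_count_regular:
  assumes x: "walk_regular n d x" and d: "1 \<le> d" "d \<le> n"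
  shows "walk_count n x = walk.chamber_number n d"
proof -
  interpret chamber_system walk_indices 0 n n "signed_perms n"
    "\<lambda>g k c. walk_coord n g c k - walk_coord n g c (Suc k)"
    by (rule walk_chamber_system)
  have R: "x ` {1..n} \<subseteq> Rspace d"
    "\<And>g. g \<in> signed_perms n \<Longrightarrow> any_independent d n (partial_sum (signed_perm_act g x))"
    using x by (auto simp: walk_regular_def)
  show ?thesis unfolding walk_count_def
  proof (rule card_hull_contains_zero[OF R(1)])
    fix g c assume g: "g \<in> signed_perms n"
    note perm = signed_permsD(1)[OF g]
    let ?y = "signed_perm_act g x"
    have "(\<Sum>i=1..n. c i *\<^sub>R x i) = (\<Sum>i=1..n. c (fst g i) *\<^sub>R x (fst g i))"
      using sum.permute[OF perm, of "\<lambda>i. c i *\<^sub>R x i"] by (simp add: comp_def)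
    also have "\<dots> = (\<Sum>i=1..n. walk_coord n g c i *\<^sub>R ?y i)"
    proof (rule sum.cong[OF refl])
      fix i assume i: "i \<in> {1..n}"
      have "walk_coord n g c i *\<^sub>R ?y i = (snd g i * snd g i) *\<^sub>R (c (fst g i) *\<^sub>R x (fst g i))"
        using i by (simp add: walk_coord_def signed_perm_act_def mult_ac)
      then show "c (fst g i) *\<^sub>R x (fst g i) = walk_coord n g c i *\<^sub>R ?y i"
        using sign_square[OF signed_permsD(2)[OF g] i] by simp
    qed
    also have "\<dots> = (\<Sum>k=1..n. (walk_coord n g c k - walk_coord n g c (Suc k)) *\<^sub>R partial_sum ?y k)"
      by (subst summation_by_parts) (simp add: walk_coord_def)
    finally show "(\<Sum>i=1..n. c i *\<^sub>R x i) =
      (\<Sum>k=1..n. (walk_coord n g c k - walk_coord n g c (Suc k)) *\<^sub>R partial_sum ?y k)" .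
    have "?y i \<in> Rspace d" if "i \<in> {1..n}" for i
    proof -
      have "fst g i \<in> {1..n}" using permutes_in_image[OF perm] that by simp
      then have "x (fst g i) \<in> Rspace d" using R(1) by blast
      then show ?thesis unfolding signed_perm_act_def by (rule subspace_scale[OF subspace_Rspace])
    qed
    then show "partial_sum ?y ` {1..n} \<subseteq> Rspace d"
      by (intro partial_sum_in_Rspace[of _ n]) auto
    show "any_independent d n (partial_sum ?y)" using R(2)[OF g] .
  qed (use d in auto)
qed

lemma ex_walk_regular: "\<exists>x. walk_regular n d x"
proof -
  define Vs where "Vs = (\<lambda>g. partial_sum (signed_perm_act g unit_config)) ` signed_perms n"
  have ind: "any_independent d n (partial_sum (signed_perm_act g unit_config))"
    if g: "g \<in> signed_perms n" for g
  proof (rule any_independent_partial_sum)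
    fix u :: "nat \<Rightarrow> real" and k
    assume sum: "(\<Sum>k=1..n. u k *\<^sub>R signed_perm_act g unit_config k) = 0" and k: "k \<in> {1..n}"
    have "(\<Sum>k=1..n. (u k * snd g k) *\<^sub>R unit_config (fst g k)) = 0"
      using sum by (simp add: signed_perm_act_def)
    then have "u k * snd g k = 0"
      using unit_combination_eq_zero[OF signed_permsD(1)[OF g], of "\<lambda>k. u k * snd g k"] k by blast
    then show "u k = 0" using signsD[OF signed_permsD(2)[OF g] k] by auto
  qed
  have keys: "partial_sum (signed_perm_act g unit_config) ` {1..n} \<subseteq> Rspace n"
    if g: "g \<in> signed_perms n" for g
  proof -
    have "signed_perm_act g unit_config i \<in> Rspace n" if "i \<in> {1..n}" for i
      unfolding signed_perm_act_def
      using permutes_in_image[OF signed_permsD(1)[OF g], of i] that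
      by (intro subspace_scale[OF subspace_Rspace] unit_config_in_Rspace) simp
    then show ?thesis by (intro partial_sum_in_Rspace[of _ n]) auto
  qed
  have "finite Vs" by (simp add: Vs_def finite_signed_perms)
  moreover have "any_independent d n v" "v ` {1..n} \<subseteq> Rspace n" if "v \<in> Vs" for v
    using that ind keys unfolding Vs_def by blast+
  ultimately obtain X where X: "linear X" "range X \<subseteq> Rspace d"
      "\<And>v. v \<in> Vs \<Longrightarrow> any_independent d n (X \<circ> v)"
    using generic_linear_map[of Vs d n n] by metis
  \<comment> \<open>A linear map commutes with the group action and with partial sums, so genericity
    for the finitely many families in \<open>Vs\<close> is enough.\<close>
  have act: "partial_sum (signed_perm_act g (X \<circ> unit_config)) =
      X \<circ> partial_sum (signed_perm_act g unit_config)" for g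
  proof -
    have "signed_perm_act g (X \<circ> unit_config) = X \<circ> signed_perm_act g unit_config"
      using linear_scale[OF X(1)] by (auto simp: signed_perm_act_def)
    then show ?thesis by (simp only:) (simp add: partial_sum_linear[OF X(1)] fun_eq_iff)
  qed
  have "walk_regular n d (X \<circ> unit_config)"
    unfolding walk_regular_def act
  proof (intro conjI ballI)
    show "(X \<circ> unit_config) ` {1..n} \<subseteq> Rspace d" using X(2) by auto
    show "any_independent d n (X \<circ> partial_sum (signed_perm_act g unit_config))"
      if "g \<in> signed_perms n" for g
      using that by (intro X(3)) (simp add: Vs_def)
  qed
  then show ?thesis by blast
qed

text \<open>Coordinate \<open>i\<close> contributes the factor
  \<open>(2 * i - 1) + 1 = 2 * i\<close>.\<close>

lemma walk_chamber_number_0: "walk.chamber_number n 0 = 2 ^ n * fact n"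
  by (induction n) (auto simp: card_walk_indices_Suc algebra_simps)

lemma N_walk_eq:
  assumes "1 \<le> n" "d \<le> n"
  shows "N_walk n d = walk.chamber_number n d"
proof -
  consider "d = 0" | "1 \<le> d" "d = n" | "1 \<le> d" "d < n" using assms by linarith
  then show ?thesis
  proof cases
    case 1
    then show ?thesis by (simp add: N_walk_def walk_chamber_number_0)
  next
    case 2
    then show ?thesis by (cases n) (auto simp: N_walk_def)
  next
    case 3
    obtain x where x: "walk_regular n d x" using ex_walk_regular by blast
    have "(THE N. \<forall>x. walk_regular n d x \<longrightarrow> walk_count n x = N) = walk.chamber_number n d"
      by (rule the_common_value[of "walk_regular n d", OF x]) (use walk_count_regular 3 in auto)
    then show ?thesis using 3 by (simp add: N_walk_def)
  qed
qed

subsection \<open>Random bridges\<close>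

text \<open>Only equalities of two coordinates occur, so constant vectors lie on all hyperplanes.
  This is the reason for \<open>off = 1\<close>: index 1 has no hyperplane, and every larger index
  has the one comparing it with coordinate 1.\<close>

interpretation bridge: root_family "\<lambda>i. {1..int i - 1}" "Suc 0"
proof unfold_locales
  fix i :: nat and j k :: int
  assume j: "j \<in> {1..int i - 1}" and k: "k \<in> {1..int i - 1}" and ne: "j \<noteq> k"
  have larger: "\<exists>i'\<in>{1..<i}. \<exists>j'\<in>{1..int i' - 1}. \<exists>s. s \<noteq> 0 \<and>
      (\<forall>c. signed_entry c j - signed_entry c k = s * root_eval (i', j') c \<and>
           signed_entry c k - signed_entry c j = (- s) * root_eval (i', j') c)"
    if "j \<in> {1..int i - 1}" "k \<in> {1..int i - 1}" "k < j" for j k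
    using that by (intro bexI[of _ "nat j"] bexI[of _ k] exI[of _ 1])
      (auto simp: root_eval_def signed_entry_def)
  show "\<exists>i'\<in>{1..<i}. \<exists>j'\<in>{1..int i' - 1}. \<exists>s. s \<noteq> 0 \<and>
      (\<forall>c. signed_entry c j - signed_entry c k = s * root_eval (i', j') c)"
  proof (cases "k < j")
    case True
    then show ?thesis using larger[OF j k] by blast
  next
    case False
    then have "j < k" using ne by simp
    then show ?thesis using larger[OF k j] neg_equal_0_iff_equal by metis
  qed
qed auto

lemma bridge_wall_root:
  assumes \<sigma>: "\<sigma> permutes {1..n}" and k: "k \<in> {1..n - 1}"
  shows "\<exists>r\<in>bridge.roots n. \<exists>s. s \<noteq> 0 \<and> (\<forall>c. c (\<sigma> k) - c (\<sigma> (Suc k)) = s * root_eval r c)"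
proof -
  let ?p = "\<sigma> k"
  let ?q = "\<sigma> (Suc k)"
  have p: "?p \<in> {1..n}" using permutes_in_image[OF \<sigma>, of k] k by auto
  have q: "?q \<in> {1..n}" using permutes_in_image[OF \<sigma>, of "Suc k"] k by auto
  have "?p \<noteq> ?q" using inj_eq[OF permutes_inj[OF \<sigma>]] by simp
  then consider "?q < ?p" | "?p < ?q" by linarith
  then show ?thesis
  proof cases
    case 1
    then show ?thesis using p q
      by (intro bexI[of _ "(?p, int ?q)"] exI[of _ 1]) (auto simp: bridge.roots_def root_eval_def)
  next
    case 2
    then show ?thesis using p q
      by (intro bexI[of _ "(?q, int ?p)"] exI[of _ "-1"]) (auto simp: bridge.roots_def root_eval_def)
  qed
qed

lemma bridge_root_nonzero:
  assumes \<sigma>: "\<sigma> permutes {1..n}" and pos: "\<forall>k\<in>{1..n - 1}. 0 < c (\<sigma> k) - c (\<sigma> (Suc k))"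
    and r: "r \<in> bridge.roots n"
  shows "root_eval r c \<noteq> 0"
proof
  assume zero: "root_eval r c = 0"
  have decr: "c (\<sigma> b) < c (\<sigma> a)" if "1 \<le> a" "a < b" "b \<le> n" for a b
    by (rule strictly_decreasing_on_interval[of n "\<lambda>i. c (\<sigma> i)"]) (use pos that in auto)
  obtain i j where ij: "r = (i, j)" "i \<in> {1..n}" "1 \<le> j" "j < int i"
    using r by (auto simp: bridge.roots_def)
  obtain a where a: "a \<in> {1..n}" "\<sigma> a = i" using in_permutation_range[OF \<sigma> ij(2)] .
  have "nat j \<in> {1..n}" using ij by auto
  then obtain b where b: "b \<in> {1..n}" "\<sigma> b = nat j" using in_permutation_range[OF \<sigma>] by blast
  have "c (\<sigma> a) = c (\<sigma> b)" using zero ij a b by (simp add: root_eval_def signed_entry_def)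
  moreover have "a \<noteq> b" using a b ij by auto
  ultimately show False using decr[of a b] decr[of b a] a(1) b(1) by (cases "a < b") auto
qed

lemma bridge_rank_ge: "card (c ` {1..n}) \<le> bridge.rank n c"
  unfolding bridge.rank_def
proof (rule card_first_occurrences_le)
  fix i assume first: "\<And>m. m \<in> {1..<i} \<Longrightarrow> c m \<noteq> c i"
  show "\<forall>j\<in>{1..int i - 1}. root_eval (i, j) c \<noteq> 0"
  proof
    fix j assume j: "j \<in> {1..int i - 1}"
    then have "nat j \<in> {1..<i}" by auto
    then have "c (nat j) \<noteq> c i" by (rule first)
    then show "root_eval (i, j) c \<noteq> 0" using j by (simp add: root_eval_def signed_entry_def)
  qed
qed auto

lemma bridge_ex_chamber:
  assumes n: "1 \<le> n"
  shows "\<exists>\<sigma>\<in>{\<sigma>. \<sigma> permutes {1..n}}. (\<forall>k\<in>{1..n - 1}. 0 \<le> c (\<sigma> k) - c (\<sigma> (Suc k))) \<and>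
    card {k \<in> {1..n - 1}. c (\<sigma> k) - c (\<sigma> (Suc k)) \<noteq> 0} + 1 \<le> bridge.rank n c"
proof -
  obtain \<sigma> where \<sigma>: "\<sigma> permutes {1..n}"
    "\<And>i j. 1 \<le> i \<Longrightarrow> i \<le> j \<Longrightarrow> j \<le> n \<Longrightarrow> c (\<sigma> j) \<le> c (\<sigma> i)"
    using ex_sorting_permutation[of n c] by blast
  let ?u = "\<lambda>i. c (\<sigma> i)"
  have Suc: "Suc (n - 1) = n" using n by simp
  have "card {k \<in> {1..n - 1}. ?u k - ?u (Suc k) \<noteq> 0} \<le> card (?u ` {1..n - 1} - {?u (Suc (n - 1))})"
    by (rule card_descents_le) (use \<sigma>(2) n in auto)
  also have "?u ` {1..n - 1} - {?u (Suc (n - 1))} \<subseteq> ?u ` {1..n} - {?u n}" using Suc by auto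
  then have "card (?u ` {1..n - 1} - {?u (Suc (n - 1))}) \<le> card (?u ` {1..n} - {?u n})"
    by (intro card_mono) auto
  \<comment> \<open>The last value in sorted order is not counted by any descent; it supplies the
    summand required by \<open>off\<close>.\<close>
  also have "\<dots> + 1 = card (?u ` {1..n})"
    using n card_Suc_Diff1[of "?u ` {1..n}" "?u n"] by auto
  also have "?u ` {1..n} = c ` {1..n}"
    using permutes_image[OF \<sigma>(1)] by (metis image_image)
  finally have "card {k \<in> {1..n - 1}. ?u k - ?u (Suc k) \<noteq> 0} + 1 \<le> bridge.rank n c"
    using bridge_rank_ge[of c n] by simp
  then show ?thesis using \<sigma> by (intro bexI[of _ \<sigma>]) auto
qed

lemma bridge_rank_le_1:
  assumes \<sigma>: "\<sigma> permutes {1..n}" and zero: "\<forall>k\<in>{1..n - 1}. c (\<sigma> k) - c (\<sigma> (Suc k)) = 0"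
  shows "bridge.rank n c \<le> 1"
proof -
  have const: "c p = c (\<sigma> (Suc (n - 1)))" if p: "p \<in> {1..n}" for p
  proof -
    obtain a where a: "a \<in> {1..n}" "\<sigma> a = p" using in_permutation_range[OF \<sigma> p] .
    have "c (\<sigma> a) = c (\<sigma> (Suc (n - 1)))"
      by (rule constant_on_interval[of _ "\<lambda>i. c (\<sigma> i)"]) (use zero a in auto)
    then show ?thesis using a by simp
  qed
  have "{i \<in> {1..n}. \<forall>j\<in>{1..int i - 1}. root_eval (i, j) c \<noteq> 0} \<subseteq> {1}"
  proof
    fix i assume i: "i \<in> {i \<in> {1..n}. \<forall>j\<in>{1..int i - 1}. root_eval (i, j) c \<noteq> 0}"
    show "i \<in> {1}"
    proof (rule ccontr)
      assume "i \<notin> {1}"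
      then have "1 \<in> {1..int i - 1}" using i by auto
      then have "root_eval (i, 1) c \<noteq> 0" using i by blast
      moreover have "c i = c 1" using const[of i] const[of 1] i by simp
      ultimately show False by (simp add: root_eval_def signed_entry_def)
    qed
  qed
  then have "bridge.rank n c \<le> card {1::nat}" unfolding bridge.rank_def by (rule card_mono[rotated]) simp
  then show ?thesis by simp
qed

lemma bridge_wall_surj:
  fixes u :: "nat \<Rightarrow> real"
  assumes \<sigma>: "\<sigma> permutes {1..n}"
  shows "\<exists>c. \<forall>k\<in>{1..n - 1}. c (\<sigma> k) - c (\<sigma> (Suc k)) = u k"
proof -
  let ?c = "\<lambda>p. \<Sum>k=inv \<sigma> p..n - 1. u k"
  have "?c (\<sigma> k) - ?c (\<sigma> (Suc k)) = u k" if "k \<in> {1..n - 1}" for k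
    unfolding permutes_inverses(2)[OF \<sigma>]
    using sum.atLeast_Suc_atMost[of k "n - 1" u] that by simp
  then show ?thesis by (intro exI[of _ ?c] ballI)
qed

lemma bridge_chamber_system:
  assumes n: "1 \<le> n"
  shows "chamber_system (\<lambda>i. {1..int i - 1}) (Suc 0) n (n - 1) {\<sigma>. \<sigma> permutes {1..n}}
    (\<lambda>\<sigma> k c. c (\<sigma> k) - c (\<sigma> (Suc k)))"
proof unfold_locales
  fix \<sigma> \<sigma>' :: "nat \<Rightarrow> nat" and c :: "nat \<Rightarrow> real"
  assume "\<sigma> \<in> {\<sigma>. \<sigma> permutes {1..n}}" "\<sigma>' \<in> {\<sigma>. \<sigma> permutes {1..n}}"
    "\<forall>k\<in>{1..n - 1}. 0 < c (\<sigma> k) - c (\<sigma> (Suc k))" "\<forall>k\<in>{1..n - 1}. 0 < c (\<sigma>' k) - c (\<sigma>' (Suc k))"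
  then show "\<sigma> = \<sigma>'" by (intro sorting_permutation_unique[of _ n c]) auto
qed (use bridge_wall_root bridge_root_nonzero bridge_ex_chamber[OF n] bridge_rank_le_1
      bridge_wall_surj in simp_all)

lemma bridge_count_regular:
  assumes x: "bridge_regular n d x" and d: "1 \<le> d" "d + 1 \<le> n"
  shows "bridge_count n x = bridge.chamber_number n d"
proof -
  have n: "1 \<le> n" using d by simp
  interpret chamber_system "\<lambda>i. {1..int i - 1}" "Suc 0" n "n - 1" "{\<sigma>. \<sigma> permutes {1..n}}"
    "\<lambda>\<sigma> k c. c (\<sigma> k) - c (\<sigma> (Suc k))"
    using n by (rule bridge_chamber_system)
  have R: "x ` {1..n} \<subseteq> Rspace d" "partial_sum x n = 0"
    "\<And>\<sigma>. \<sigma> permutes {1..n} \<Longrightarrow> any_independent d (n - 1) (partial_sum (x \<circ> \<sigma>))"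
    using x by (auto simp: bridge_regular_def)
  have "bridge_count n x =
      card {\<sigma> \<in> {\<sigma>. \<sigma> permutes {1..n}}. hull_contains_zero (n - 1) (partial_sum (x \<circ> \<sigma>))}"
    by (simp add: bridge_count_def)
  also have "\<dots> = bridge.chamber_number n d"
  proof (rule card_hull_contains_zero[OF R(1)])
    fix \<sigma> :: "nat \<Rightarrow> nat" and c :: "nat \<Rightarrow> real" assume "\<sigma> \<in> {\<sigma>. \<sigma> permutes {1..n}}"
    then have \<sigma>: "\<sigma> permutes {1..n}" by simp
    let ?u = "\<lambda>i. c (\<sigma> i)"
    let ?y = "x \<circ> \<sigma>"
    have last: "partial_sum ?y n = 0"
      using R(2) sum.permute[OF \<sigma>, of x] by (simp add: partial_sum_def)
    have "(\<Sum>i=1..n. c i *\<^sub>R x i) = (\<Sum>i=1..n. ?u i *\<^sub>R ?y i)"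
      using sum.permute[OF \<sigma>, of "\<lambda>i. c i *\<^sub>R x i"] by (simp add: comp_def)
    also have "\<dots> = (\<Sum>k=1..n. (?u k - ?u (Suc k)) *\<^sub>R partial_sum ?y k)"
      by (subst summation_by_parts) (simp add: last)
    \<comment> \<open>The last partial sum is 0, so the term \<open>k = n\<close> drops out together
      with the boundary term and \<open>n - 1\<close> walls remain.\<close>
    also have "\<dots> = (\<Sum>k=1..n - 1. (?u k - ?u (Suc k)) *\<^sub>R partial_sum ?y k)"
      using n last by (cases n) auto
    finally show "(\<Sum>i=1..n. c i *\<^sub>R x i) = (\<Sum>k=1..n - 1. (?u k - ?u (Suc k)) *\<^sub>R partial_sum ?y k)" .
    have "?y i \<in> Rspace d" if "i \<in> {1..n}" for i
      using R(1) permutes_in_image[OF \<sigma>, of i] that by (simp add: image_subset_iff)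
    then have "?y ` {1..n} \<subseteq> Rspace d" by blast
    then show "partial_sum ?y ` {1..n - 1} \<subseteq> Rspace d" by (rule partial_sum_in_Rspace) simp
    show "any_independent d (n - 1) (partial_sum ?y)" using R(3)[OF \<sigma>] .
  qed (use d in auto)
  finally show ?thesis .
qed

lemma ex_bridge_regular:
  assumes n: "1 \<le> n"
  shows "\<exists>x. bridge_regular n d x"
proof -
  let ?S = "\<Sum>j=1..n. unit_config j"
  \<comment> \<open>Unit vectors shifted by their mean: the vertices of a simplex centred at 0, so
    they add up to 0 while any \<open>n - 1\<close> of them are independent.\<close>
  define b where "b i = unit_config i - (1 / real n) *\<^sub>R ?S" for i
  have S: "Poly_Mapping.lookup ?S p = 1" if "p \<in> {1..n}" for p
    using that by (simp add: lookup_sum lookup_unit_config sum.delta')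
  have b_Rspace: "b i \<in> Rspace n" if "i \<in> {1..n}" for i
    unfolding b_def using that
    by (intro subspace_diff[OF subspace_Rspace] subspace_scale[OF subspace_Rspace]
        subspace_sum[OF subspace_Rspace] unit_config_in_Rspace)
  have "partial_sum b n = ?S - (\<Sum>j=1..n. (1 / real n) *\<^sub>R ?S)"
    unfolding partial_sum_def b_def by (rule sum_subtractf)
  then have b_sum: "partial_sum b n = 0" using n by (simp add: sum_constant_scaleR del: sum_constant)
  define Vs where "Vs = (\<lambda>\<sigma>. partial_sum (b \<circ> \<sigma>)) ` {\<sigma>. \<sigma> permutes {1..n}}"
  have ind: "any_independent d (n - 1) (partial_sum (b \<circ> \<sigma>))" if \<sigma>: "\<sigma> permutes {1..n}" for \<sigma>
  proof (rule any_independent_partial_sum)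
    fix u :: "nat \<Rightarrow> real" and k
    assume sum: "(\<Sum>k=1..n - 1. u k *\<^sub>R (b \<circ> \<sigma>) k) = 0" and k: "k \<in> {1..n - 1}"
    have eq: "(\<Sum>k=1..n - 1. if k = m then u k else 0) = (\<Sum>k=1..n - 1. u k) / real n"
      if m: "m \<in> {1..n}" for m
    proof -
      have p: "\<sigma> m \<in> {1..n}" using permutes_in_image[OF \<sigma>] m by simp
      have "\<sigma> k = \<sigma> m \<longleftrightarrow> k = m" for k using inj_eq[OF permutes_inj[OF \<sigma>]] by blast
      then have entry: "u k * Poly_Mapping.lookup (b (\<sigma> k)) (\<sigma> m) =
          (if k = m then u k else 0) - u k / real n" for k
        using S[OF p] by (simp add: b_def lookup_minus lookup_unit_config right_diff_distrib)
      have "0 = Poly_Mapping.lookup (\<Sum>k=1..n - 1. u k *\<^sub>R (b \<circ> \<sigma>) k) (\<sigma> m)"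
        using sum by simp
      also have "\<dots> = (\<Sum>k=1..n - 1. (if k = m then u k else 0) - u k / real n)"
        by (simp add: lookup_sum entry)
      finally show ?thesis by (simp add: sum_subtractf sum_divide_distrib)
    qed
    \<comment> \<open>Coordinate \<open>\<sigma> n\<close> belongs to none of the
      \<open>n - 1\<close> vectors in the relation; reading it gives total weight 0, and the other
      coordinates then give \<open>u k = 0\<close>.\<close>
    have "(\<Sum>k=1..n - 1. if k = n then u k else 0) = 0" using n by (intro sum.neutral) auto
    then have "(\<Sum>k=1..n - 1. u k) / real n = 0" using eq[of n] n by simp
    moreover have "k \<in> {1..n}" using k by auto
    then have "u k = (\<Sum>k=1..n - 1. u k) / real n" using eq[of k] k by (simp add: sum.delta)
    ultimately show "u k = 0" by simp
  qed
  have keys: "partial_sum (b \<circ> \<sigma>) ` {1..n - 1} \<subseteq> Rspace n" if \<sigma>: "\<sigma> permutes {1..n}" for \<sigma>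
  proof (rule partial_sum_in_Rspace[of _ n])
    show "(b \<circ> \<sigma>) ` {1..n} \<subseteq> Rspace n"
      using b_Rspace permutes_in_image[OF \<sigma>] by auto
  qed simp
  have "finite Vs" by (simp add: Vs_def finite_permutations)
  moreover have "any_independent d (n - 1) v" "v ` {1..n - 1} \<subseteq> Rspace n" if "v \<in> Vs" for v
    using that ind keys unfolding Vs_def by blast+
  ultimately obtain X where X: "linear X" "range X \<subseteq> Rspace d"
      "\<And>v. v \<in> Vs \<Longrightarrow> any_independent d (n - 1) (X \<circ> v)"
    using generic_linear_map[of Vs d "n - 1" n] by metis
  have "bridge_regular n d (X \<circ> b)"
    unfolding bridge_regular_def
  proof (intro conjI allI impI)
    show "(X \<circ> b) ` {1..n} \<subseteq> Rspace d" using X(2) by auto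
    show "partial_sum (X \<circ> b) n = 0"
      using b_sum by (simp add: partial_sum_linear[OF X(1)] linear_0[OF X(1)])
    show "any_independent d (n - 1) (partial_sum ((X \<circ> b) \<circ> \<sigma>))" if \<sigma>: "\<sigma> permutes {1..n}" for \<sigma>
    proof -
      have "partial_sum ((X \<circ> b) \<circ> \<sigma>) = X \<circ> partial_sum (b \<circ> \<sigma>)"
        using partial_sum_linear[OF X(1), of "b \<circ> \<sigma>"] by (auto simp: fun_eq_iff comp_assoc)
      then show ?thesis using X(3)[of "partial_sum (b \<circ> \<sigma>)"] \<sigma> by (simp add: Vs_def)
    qed
  qed
  then show ?thesis by blast
qed

lemma bridge_chamber_number_0: "bridge.chamber_number n 0 = fact n"
  by (induction n) (auto simp: algebra_simps)

text \<open>For \<open>n = d + 1\<close> the convention 0 fits the geometry: a kernel in general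
  position contains only constant vectors on \<open>{1..n}\<close>, and these lie on every
  hyperplane.\<close>

lemma N_br_eq:
  assumes "2 \<le> n" "d + 1 \<le> n"
  shows "N_br n d = bridge.chamber_number n d"
proof -
  consider "d = 0" | "1 \<le> d" "n = d + 1" | "1 \<le> d" "d + 1 < n" using assms by linarith
  then show ?thesis
  proof cases
    case 1
    then show ?thesis by (simp add: N_br_def bridge_chamber_number_0)
  next
    case 2
    then show ?thesis by (simp add: N_br_def)
  next
    case 3
    obtain x where x: "bridge_regular n d x" using ex_bridge_regular[of n d] assms by auto
    have "(THE N. \<forall>x. bridge_regular n d x \<longrightarrow> bridge_count n x = N) = bridge.chamber_number n d"
      by (rule the_common_value[of "bridge_regular n d", OF x]) (use bridge_count_regular 3 in auto)
    then show ?thesis using 3 by (simp add: N_br_def)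
  qed
qed

theorem theorem17:
  fixes d :: nat
  assumes "d \<ge> 1"
  shows "(\<forall>n \<ge> d + 1. N_Wend n d = N_Wend (n - 1) d + N_Wend (n - 1) (d - 1)) \<and>
         (\<forall>n \<ge> d + 1. N_walk n d = (2 * n - 1) * N_walk (n - 1) d + N_walk (n - 1) (d - 1)) \<and>
         (\<forall>n \<ge> d + 2. N_br n d = (n - 1) * N_br (n - 1) d + N_br (n - 1) (d - 1))"
  proof (intro conjI allI impI)
  fix n assume n: "d + 1 \<le> n"
  then obtain m where m: "n = Suc m" by (cases n) auto
  show "N_Wend n d = N_Wend (n - 1) d + N_Wend (n - 1) (d - 1)"
    \<comment> \<open>Since \<open>d \<le> m\<close>, the guard in \<open>chamber_number\<close>
      fails and its recursion is the asserted one, with \<open>card (J (Suc m)) = 1\<close>; all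
      arguments are in the range of \<open>N_Wend_eq\<close>.\<close>
    using n assms by (simp add: m N_Wend_eq)
  show "N_walk n d = (2 * n - 1) * N_walk (n - 1) d + N_walk (n - 1) (d - 1)"
    using n assms by (simp add: m N_walk_eq card_walk_indices_Suc)
next
  fix n assume n: "d + 2 \<le> n"
  then obtain m where m: "n = Suc m" by (cases n) auto
  show "N_br n d = (n - 1) * N_br (n - 1) d + N_br (n - 1) (d - 1)"
    \<comment> \<open>From \<open>d \<ge> 1\<close> follows \<open>m \<ge> 2\<close>, so the smaller
      numbers are in range as well; the factor is \<open>card {1..int m} = m\<close>.\<close>
    using n assms by (simp add: m N_br_eq)
qed

end
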